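(* In any $\mathbb{Z}^n$-invariant triangulation of $\mathbb{R}^n$, the number of $\mathbb{Z}^n$-orbits of $n$-dimensional simplices is at least $\operatorname{rank}_{\mathbb{R}}(\det_n)\geq \frac{n^{n-1}}{(n-1)!}$.
   Context: A $\mathbb{Z}^n$-invariant triangulation of $\mathbb{R}^n$ is a simplicial complex with a free simplicial $\mathbb{Z}^n$-action which is $\mathbb{Z}^n$-equivariantly homeomorphic to $\mathbb{R}^n$ with $\mathbb{Z}^n$ acting by translations; equivalently, a tiling of $\mathbb{R}^n$ by (possibly curved, i.e. not necessarily linear) $n$-simplices meeting face-to-face and invariant under integer translations. The homeomorphism need not be linear on simplices. For a tensor $T\in V^{\otimes n}$ over a field $\mathbb{K}$, $\operatorname{rank}_{\mathbb{K}}(T)$ is the minimal $r$ with $T=\sum_{i=1}^r v_{i,1}\otimes\cdots\otimes v_{i,n}$, $v_{i,j}\in V$. The determinant tensor is $\det_n=\sum_{\pi\in S_n}\operatorname{sgn}(\pi)\, e_{\pi(1)}\otimes\cdots\otimes e_{\pi(n)}\in(\mathbb{R}^n)^{\otimes n}$. *)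

theory Defs
  imports "HOL-Analysis.Analysis"
begin

section \<open>Abstract simplicial complexes and their geometric realization\<close>

definition abstract_complex :: "'v set set \<Rightarrow> bool" where
  "abstract_complex K \<longleftrightarrow>
     (\<forall>\<sigma>\<in>K. finite \<sigma> \<and> \<sigma> \<noteq> {}) \<and>
     (\<forall>\<sigma>\<in>K. \<forall>\<tau>. \<tau> \<subseteq> \<sigma> \<longrightarrow> \<tau> \<noteq> {} \<longrightarrow> \<tau> \<in> K)"

definition simplices_of_dim :: "'v set set \<Rightarrow> nat \<Rightarrow> 'v set set" where
  "simplices_of_dim K d = {\<sigma>\<in>K. card \<sigma> = d + 1}"

text \<open>Points of the geometric realization are given by their barycentric coordinates.\<close>

definition realization :: "'v set set \<Rightarrow> ('v \<Rightarrow> real) set" where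
  "realization K =
     {x. (\<forall>v. 0 \<le> x v) \<and> {v. x v \<noteq> 0} \<in> K \<and> (\<Sum>v\<in>{v. x v \<noteq> 0}. x v) = 1}"

definition closed_cell :: "'v set set \<Rightarrow> 'v set \<Rightarrow> ('v \<Rightarrow> real) set" where
  "closed_cell K \<sigma> = {x \<in> realization K. {v. x v \<noteq> 0} \<subseteq> \<sigma>}"

text \<open>
  The realization carries the weak topology: a set is open iff its trace on every closed
  simplex is open. A closed simplex has the topology induced by pointwise convergence of the
  barycentric coordinates, which is the usual Euclidean one because only finitely many
  coordinates can be nonzero on it.
\<close>

definition realization_topology :: "'v set set \<Rightarrow> ('v \<Rightarrow> real) topology" where
  "realization_topology K = topology (\<lambda>U. U \<subseteq> realization K \<and>
     (\<forall>\<sigma>\<in>K. openin (top_of_set (closed_cell K \<sigma>)) (U \<inter> closed_cell K \<sigma>)))"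

lemma openin_realization_topology:
  "openin (realization_topology K) U \<longleftrightarrow> U \<subseteq> realization K \<and>
     (\<forall>\<sigma>\<in>K. openin (top_of_set (closed_cell K \<sigma>)) (U \<inter> closed_cell K \<sigma>))"
proof -
  let ?L = "\<lambda>U. U \<subseteq> realization K \<and>
     (\<forall>\<sigma>\<in>K. openin (top_of_set (closed_cell K \<sigma>)) (U \<inter> closed_cell K \<sigma>))"
  have "istopology ?L"
    unfolding istopology_def
  proof (intro conjI allI impI)
    fix S T assume S: "?L S" and T: "?L T"
    then show "S \<inter> T \<subseteq> realization K" by blast
    have "(S \<inter> T) \<inter> C = (S \<inter> C) \<inter> (T \<inter> C)" for C by blast
    then show "\<forall>\<sigma>\<in>K. openin (top_of_set (closed_cell K \<sigma>)) (S \<inter> T \<inter> closed_cell K \<sigma>)"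
      using S T by (metis openin_Int)
  next
    fix \<U> assume U: "\<forall>U\<in>\<U>. ?L U"
    then show "\<Union>\<U> \<subseteq> realization K" by blast
    show "\<forall>\<sigma>\<in>K. openin (top_of_set (closed_cell K \<sigma>)) (\<Union>\<U> \<inter> closed_cell K \<sigma>)"
    proof
      fix \<sigma> assume "\<sigma> \<in> K"
      then have "openin (top_of_set (closed_cell K \<sigma>)) (\<Union>U\<in>\<U>. U \<inter> closed_cell K \<sigma>)"
        using U by (intro openin_Union) blast
      then show "openin (top_of_set (closed_cell K \<sigma>)) (\<Union>\<U> \<inter> closed_cell K \<sigma>)"
        by (simp only: Int_Union2)
    qed
  qed
  then show ?thesis
    by (simp add: realization_topology_def topology_inverse')
qed

lemma topspace_realization_topology [simp]:
  "topspace (realization_topology K) = realization K"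
proof -
  have "realization K \<inter> closed_cell K \<sigma> = closed_cell K \<sigma>" for \<sigma>
    by (auto simp: closed_cell_def)
  then have "openin (realization_topology K) (realization K)"
    by (simp add: openin_realization_topology)
  then show ?thesis
    by (metis openin_realization_topology openin_subset openin_topspace subset_antisym)
qed

text \<open>
  The map on barycentric coordinates that extends the vertex map \<open>f\<close> affinely over simplices.
\<close>

definition realize_map :: "('v \<Rightarrow> 'w) \<Rightarrow> ('v \<Rightarrow> real) \<Rightarrow> ('w \<Rightarrow> real)" where
  "realize_map f x = (\<lambda>w. \<Sum>v\<in>{v. x v \<noteq> 0 \<and> f v = w}. x v)"

section \<open>Lattice actions and invariant triangulations\<close>

definition lattice_vec :: "int ^ 'n \<Rightarrow> real ^ 'n" where
  "lattice_vec g = (\<chi> i. of_int (g $ i))"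

text \<open>Only the values of the action on the vertex set \<open>\<Union>K\<close> matter.\<close>

definition simplicial_action :: "'v set set \<Rightarrow> ('g::group_add \<Rightarrow> 'v \<Rightarrow> 'v) \<Rightarrow> bool" where
  "simplicial_action K act \<longleftrightarrow>
     (\<forall>v\<in>\<Union>K. act 0 v = v) \<and>
     (\<forall>g h. \<forall>v\<in>\<Union>K. act (g + h) v = act g (act h v)) \<and>
     (\<forall>g. \<forall>\<sigma>\<in>K. act g ` \<sigma> \<in> K)"

definition free_action :: "'v set set \<Rightarrow> ('g::group_add \<Rightarrow> 'v \<Rightarrow> 'v) \<Rightarrow> bool" where
  "free_action K act \<longleftrightarrow>
     (\<forall>g. \<forall>x\<in>realization K. realize_map (act g) x = x \<longrightarrow> g = 0)"

definition invariant_triangulation ::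
    "'v set set \<Rightarrow> (int ^ 'n \<Rightarrow> 'v \<Rightarrow> 'v) \<Rightarrow> bool" where
  "invariant_triangulation K act \<longleftrightarrow>
     abstract_complex K \<and> simplicial_action K act \<and> free_action K act \<and>
     (\<exists>h :: ('v \<Rightarrow> real) \<Rightarrow> real ^ 'n.
        homeomorphic_map (realization_topology K) euclidean h \<and>
        (\<forall>g. \<forall>x\<in>realization K. h (realize_map (act g) x) = h x + lattice_vec g))"

text \<open>
  An invariant triangulation has finitely many orbits of simplices, because it is locally finite
  and the quotient by the lattice is compact; so \<open>card\<close> of the following set is their number.
\<close>

definition simplex_orbits ::
    "'v set set \<Rightarrow> ('g \<Rightarrow> 'v \<Rightarrow> 'v) \<Rightarrow> nat \<Rightarrow> 'v set set set" where
  "simplex_orbits K act d = (\<lambda>\<sigma>. range (\<lambda>g. act g ` \<sigma>)) ` simplices_of_dim K d"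

section \<open>Tensors\<close>

text \<open>
  A tensor over \<open>V = 'k ^ 'd\<close> whose factors are labelled by the finite type \<open>'m\<close> is represented
  by its coordinates in the standard basis: \<open>I :: 'm \<Rightarrow> 'd\<close> is the multi-index of the basis
  tensor whose factor \<open>j\<close> is the basis vector with index \<open>I j\<close>.
\<close>

type_synonym ('k, 'd, 'm) tensor = "('m \<Rightarrow> 'd) \<Rightarrow> 'k"

definition pure_tensor :: "('m::finite \<Rightarrow> 'k::field ^ 'd) \<Rightarrow> ('k, 'd, 'm) tensor" where
  "pure_tensor v = (\<lambda>I. \<Prod>j\<in>UNIV. v j $ I j)"

definition tensor_rank :: "('k::field, 'd::finite, 'm::finite) tensor \<Rightarrow> nat" where
  "tensor_rank T =
     (LEAST r. \<exists>v :: nat \<Rightarrow> 'm \<Rightarrow> 'k ^ 'd. T = (\<lambda>I. \<Sum>i<r. pure_tensor (v i) I))"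

text \<open>The \<open>n\<close> basis vectors and the \<open>n\<close> tensor factors are labelled by the same type.\<close>

definition det_tensor :: "('k::field, 'n::finite, 'n) tensor" where
  "det_tensor = (\<lambda>I. \<Sum>\<pi> | \<pi> permutes (UNIV :: 'n set).
     of_int (sign \<pi>) * pure_tensor (\<lambda>j. axis (\<pi> j) 1) I)"

end

theory Submission
  imports Defs
begin

text \<open>
  For the orbit count, write every vertex as \<open>v = act (coord v) (base v)\<close>. A fine cubical
  grid on \<open>\<real>\<^sup>n\<close> maps simplicially to \<open>K\<close> by sending a grid point to a vertex whose open star
  contains a ball around it, and every face of the grid is sent to the corner whose coordinate is
  least for a translation-invariant total order. Summing the cup product of the coordinate
  cocycles over all flags of cubical faces in a period gives the determinant tensor up to a
  factor: this is the cup product in the cohomology of the torus, and modulo coboundaries the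
  cocycles may be replaced by linear functions. A flag contributes zero or the pure tensor of the
  successive differences of the ordered vertices of an \<open>n\<close>-simplex of \<open>K\<close>, which depends only on
  its orbit. Thus the determinant tensor lies in the span of one pure tensor for each orbit.

  The rank bound comes from a Koszul flattening. Contracting the \<open>k\<close>-th factor with the \<open>k\<close>-th exterior power,
  \<open>k = 1, \<dots>, n\<close>, turns a tensor into an operator
  \<open>\<Otimes> \<Lambda>\<^sup>k \<rightarrow> \<Otimes> \<Lambda>\<^bsup>k - 1\<^esup>\<close>. A pure tensor gives
  rank at most \<open>\<Prod> C(n - 1, k - 1)\<close>. The determinant gives an injective operator,
  because it is a composition of operators
  \<open>\<Lambda>\<^bsup>k - 1\<^esup> \<otimes> \<Lambda>\<^sup>k \<rightarrow> \<Lambda>\<^sup>k \<otimes> \<Lambda>\<^bsup>k - 1\<^esup>\<close> which are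
  reflections of an \<open>sl\<^sub>2\<close>-action. Hence the rank is at least \<open>\<Prod> C(n, k) / C(n - 1, k - 1) = n\<^sup>n / n!\<close>.
\<close>

section \<open>Creation and annihilation operators\<close>

text \<open>The sign of moving the basis vector \<open>i\<close> past the elements of
  \<open>R\<close> that precede it; the index type is ordered through \<open>to_nat\<close>.\<close>

definition fsgn :: "'n::finite \<Rightarrow> 'n set \<Rightarrow> real" where
  "fsgn i R = (\<Prod>r\<in>R. if to_nat r < to_nat i then - 1 else 1)"

lemma fsgn_insert: "y \<notin> R \<Longrightarrow> fsgn i (insert y R) = (if to_nat y < to_nat i then - 1 else 1) * fsgn i R"
  by (simp add: fsgn_def)

lemma fsgn_insert_self [simp]: "fsgn i (insert i R) = fsgn i R"
  by (cases "i \<in> R") (auto simp: fsgn_insert insert_absorb)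

lemma fsgn_Diff_self [simp]: "fsgn i (R - {i}) = fsgn i R"
  using fsgn_insert_self[of i "R - {i}"] by (cases "i \<in> R") (auto simp: insert_absorb)

lemma fsgn_sq [simp]: "fsgn i R * fsgn i R = 1"
proof -
  have "fsgn i R * fsgn i R = (\<Prod>r\<in>R. (if to_nat r < to_nat i then - 1 else 1) * (if to_nat r < to_nat i then - 1 else 1))"
    unfolding fsgn_def by (rule prod.distrib[symmetric])
  also have "\<dots> = 1" by (rule prod.neutral) auto
  finally show ?thesis .
qed

lemma fsgn_sq_left [simp]: "fsgn i R * (fsgn i R * c) = c"
  by (metis fsgn_sq mult.assoc mult_1)

lemma fsgn_nonzero [simp]: "fsgn i R \<noteq> 0"
  using fsgn_sq[of i R] by force

text \<open>One of \<open>i\<close> and \<open>j\<close> precedes the other, so exactly one of the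
  two insertions flips a sign.\<close>

lemma fsgn_anticommute:
  assumes "i \<noteq> j" "i \<notin> R" "j \<notin> R"
  shows "fsgn i R * fsgn j (insert i R) = - (fsgn j R * fsgn i (insert j R))"
proof -
  have "to_nat i \<noteq> to_nat j" using assms by simp
  then show ?thesis using assms by (auto simp: fsgn_insert)
qed

lemma fsgn_anticommute':
  assumes "i \<noteq> j" "i \<notin> R" "j \<notin> R"
  shows "fsgn j (insert i R) * fsgn i (insert j R) = - (fsgn i R * fsgn j R)"
proof -
  have "to_nat i \<noteq> to_nat j" using assms by simp
  then show ?thesis using assms by (auto simp: fsgn_insert)
qed

text \<open>An exterior form is given by its coefficients on subsets of the basis. This operator is
  left multiplication by a basis vector; \<open>annih\<close> is contraction with the dual basis
  vector.\<close>

definition create :: "'n::finite \<Rightarrow> ('n set \<Rightarrow> real) \<Rightarrow> 'n set \<Rightarrow> real" where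
  "create i g R = (if i \<in> R then fsgn i R * g (R - {i}) else 0)"

definition annih :: "'n::finite \<Rightarrow> ('n set \<Rightarrow> real) \<Rightarrow> 'n set \<Rightarrow> real" where
  "annih i g R = (if i \<in> R then 0 else fsgn i R * g (insert i R))"

text \<open>With the next two lemmas, these are the canonical anticommutation relations. For
  distinct indices each reduces to the sign rule for two insertions.\<close>

lemma create_create: "create i (create j g) R = - create j (create i g) R"
proof (cases "i \<noteq> j \<and> i \<in> R \<and> j \<in> R")
  case True
  define Q where "Q = R - {i, j}"
  have R: "R = insert i (insert j Q)" "i \<notin> Q" "j \<notin> Q"
    using True by (auto simp: Q_def)
  have 1: "R - {i} = insert j Q" "R - {j} = insert i Q" "insert i Q - {i} = Q" "insert j Q - {j} = Q"
    using R True by auto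
  have "fsgn i R = fsgn i (insert j Q)" "fsgn j R = fsgn j (insert i Q)"
    using fsgn_Diff_self[of i R] fsgn_Diff_self[of j R] 1 by simp_all
  with fsgn_anticommute[of i j Q] True R 1 show ?thesis
    by (simp add: create_def algebra_simps)
qed (auto simp: create_def)

lemma annih_annih: "annih i (annih j g) R = - annih j (annih i g) R"
proof (cases "i \<noteq> j \<and> i \<notin> R \<and> j \<notin> R")
  case True
  then have "i \<noteq> j" "j \<noteq> i" "i \<notin> R" "j \<notin> R" by auto
  then show ?thesis
    using fsgn_anticommute[of i j R]
    by (simp add: annih_def insert_commute[of j i] mult.assoc [symmetric])
qed (auto simp: annih_def)

lemma annih_create: "annih j (create i g) R = (if i = j then g R else 0) - create i (annih j g) R"
proof (cases "i = j")
  case True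
  then show ?thesis by (auto simp: annih_def create_def insert_absorb)
next
  case ne: False
  show ?thesis
  proof (cases "i \<in> R \<and> j \<notin> R")
    case True
    define Q where "Q = R - {i}"
    have R: "R = insert i Q" "i \<notin> Q" "j \<notin> Q" using True by (auto simp: Q_def)
    have "insert j R - {i} = insert j Q" using R ne by auto
    moreover have "fsgn i (insert j R) = fsgn i (insert j Q)"
      using fsgn_Diff_self[of i "insert j R"] R ne by (simp add: insert_Diff_if)
    ultimately show ?thesis
      using ne R True fsgn_anticommute'[of i j Q]
      by (simp add: annih_def create_def mult.assoc [symmetric])
  qed (use ne in \<open>auto simp: annih_def create_def\<close>)
qed

lemma create_sum: "create i (\<lambda>R. \<Sum>x\<in>X. f x R) R = (\<Sum>x\<in>X. create i (f x) R)"
  by (simp add: create_def sum_distrib_left)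

lemma annih_sum: "annih i (\<lambda>R. \<Sum>x\<in>X. f x R) R = (\<Sum>x\<in>X. annih i (f x) R)"
  by (simp add: annih_def sum_distrib_left)

section \<open>Transposes and an sl2-action on pairs of forms\<close>

lemma sum_create_adjoint:
  "(\<Sum>R\<in>UNIV. f R * create i g R) = (\<Sum>R\<in>UNIV. annih i f R * g R)"
proof -
  have "(\<Sum>R\<in>UNIV. f R * create i g R) = (\<Sum>R | i \<in> R. f R * (fsgn i R * g (R - {i})))"
    by (rule sum.mono_neutral_cong_right) (auto simp: create_def)
  also have "\<dots> = (\<Sum>R | i \<notin> R. f (insert i R) * (fsgn i R * g R))"
    by (rule sum.reindex_bij_witness[where i = "insert i" and j = "\<lambda>R. R - {i}"])
       (auto simp: insert_absorb)
  also have "\<dots> = (\<Sum>R\<in>UNIV. annih i f R * g R)"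
    by (rule sum.mono_neutral_cong_left) (auto simp: annih_def)
  finally show ?thesis .
qed

text \<open>Acts on the tensor product of two exterior algebras: an index is contracted out of the
  second form and multiplied into the first. Together with \<open>lower_op\<close> it generates an
  sl2-action.\<close>

definition raise_op :: "('n::finite set \<Rightarrow> 'n set \<Rightarrow> real) \<Rightarrow> 'n set \<Rightarrow> 'n set \<Rightarrow> real" where
  "raise_op g R S = (\<Sum>i\<in>UNIV. create i (\<lambda>R'. annih i (g R') S) R)"

definition lower_op :: "('n::finite set \<Rightarrow> 'n set \<Rightarrow> real) \<Rightarrow> 'n set \<Rightarrow> 'n set \<Rightarrow> real" where
  "lower_op g R S = (\<Sum>i\<in>UNIV. annih i (\<lambda>R'. create i (g R') S) R)"

lemma sum_raise_adjoint:
  "(\<Sum>R\<in>UNIV. \<Sum>S\<in>UNIV. f R S * raise_op g R S) = (\<Sum>R\<in>UNIV. \<Sum>S\<in>UNIV. lower_op f R S * g R S)"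
proof -
  have "(\<Sum>R\<in>UNIV. \<Sum>S\<in>UNIV. f R S * raise_op g R S)
      = (\<Sum>i\<in>UNIV. \<Sum>S\<in>UNIV. \<Sum>R\<in>UNIV. f R S * create i (\<lambda>R'. annih i (g R') S) R)"
    unfolding raise_op_def sum_distrib_left
    by (subst sum.swap, subst (2) sum.swap, subst sum.swap) (rule refl)
  also have "\<dots> = (\<Sum>i\<in>UNIV. \<Sum>R\<in>UNIV. \<Sum>S\<in>UNIV. annih i (\<lambda>R'. f R' S) R * annih i (g R) S)"
    unfolding sum_create_adjoint by (subst (2) sum.swap) (rule refl)
  also have "\<dots> = (\<Sum>i\<in>UNIV. \<Sum>R\<in>UNIV. \<Sum>S\<in>UNIV. create i (\<lambda>S'. annih i (\<lambda>R'. f R' S') R) S * g R S)"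
    using sum_create_adjoint by (metis (no_types, lifting) mult.commute sum.cong)
  also have "\<dots> = (\<Sum>R\<in>UNIV. \<Sum>S\<in>UNIV. lower_op f R S * g R S)"
  proof -
    have "create i (\<lambda>S'. annih i (\<lambda>R'. f R' S') R) S = annih i (\<lambda>R'. create i (f R') S) R" for i R S
      by (auto simp: create_def annih_def)
    then show ?thesis
      unfolding lower_op_def sum_distrib_right
      by (subst sum.swap, subst (2) sum.swap) simp
  qed
  finally show ?thesis .
qed

text \<open>The sl2 commutator. Operators on different factors commute, so only the terms
  \<open>i = j\<close> of the anticommutation relations survive, and they add up to the difference
  of the degrees.\<close>

lemma lower_raise:
  "lower_op (raise_op g) R S = raise_op (lower_op g) R S + (real (card S) - real (card R)) * g R S"
proof -
  \<comment> \<open>The common normal form of the summands of both compositions: creation outermost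
    on the first factor, annihilation outermost on the second.\<close>
  define X where "X i j = create i (\<lambda>R'. annih j (\<lambda>R''. annih i (\<lambda>S'. create j (g R'') S') S) R') R" for i j
  have 1: "annih j (\<lambda>R'. create j (\<lambda>S'. create i (\<lambda>R''. annih i (g R'') S') R') S) R =
      X i j + (if i = j then (if i \<in> S then g R S else 0) - (if i \<in> R then g R S else 0) else 0)" for i j
  proof -
    have "annih j (\<lambda>R'. create j (\<lambda>S'. create i (\<lambda>R''. annih i (g R'') S') R') S) R
        = annih j (create i (\<lambda>R''. create j (annih i (g R'')) S)) R"
      by (auto simp: create_def annih_def)
    also have "\<dots> = annih j (create i (\<lambda>R''. (if i = j then g R'' S else 0) - annih i (create j (g R'')) S)) R"
      by (simp add: annih_create eq_commute)
    also have "\<dots> = X i j + (if i = j then (if i \<in> S then g R S else 0) - (if i \<in> R then g R S else 0) else 0)"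
      unfolding annih_create X_def
      by (auto simp: create_def annih_def insert_absorb algebra_simps)
    finally show ?thesis .
  qed
  have "lower_op (raise_op g) R S = (\<Sum>j\<in>UNIV. \<Sum>i\<in>UNIV. annih j (\<lambda>R'. create j (\<lambda>S'. create i (\<lambda>R''. annih i (g R'') S') R') S) R)"
    unfolding lower_op_def raise_op_def create_sum annih_sum ..
  also have "\<dots> = (\<Sum>j\<in>UNIV. \<Sum>i\<in>UNIV. X i j) + (\<Sum>j\<in>UNIV. (if j \<in> S then g R S else 0) - (if j \<in> R then g R S else 0))"
    unfolding 1 by (simp add: sum.distrib)
  also have "(\<Sum>j\<in>UNIV. (if j \<in> S then g R S else 0) - (if j \<in> R then g R S else 0)) = (real (card S) - real (card R)) * g R S"
    by (simp add: sum_subtractf sum.If_cases algebra_simps)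
  also have "(\<Sum>j\<in>UNIV. \<Sum>i\<in>UNIV. X i j) = raise_op (lower_op g) R S"
  proof -
    have "raise_op (lower_op g) R S = (\<Sum>i\<in>UNIV. \<Sum>j\<in>UNIV. create i (\<lambda>R'. annih i (\<lambda>S'. annih j (\<lambda>R''. create j (g R'') S') R') S) R)"
      unfolding lower_op_def raise_op_def create_sum annih_sum ..
    moreover have "create i (\<lambda>R'. annih i (\<lambda>S'. annih j (\<lambda>R''. create j (g R'') S') R') S) R = X i j" for i j
      unfolding X_def by (auto simp: create_def annih_def)
    ultimately show ?thesis by (subst sum.swap) simp
  qed
  finally show ?thesis .
qed

text \<open>The commutator rewrites the squared norm of \<open>raise_op g\<close> as the squared
  norm of \<open>lower_op g\<close> plus a sum of squares with weights
  \<open>card S - card R\<close>, which are positive on the support of \<open>g\<close>. Both parts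
  must vanish.\<close>

lemma raise_injective:
  assumes supp: "\<And>R S. g R S \<noteq> 0 \<Longrightarrow> card R < card S"
    and zero: "\<And>R S. raise_op g R S = 0"
  shows "g R S = 0"
proof -
  have "0 = (\<Sum>R\<in>UNIV. \<Sum>S\<in>UNIV. raise_op g R S * raise_op g R S)" using zero by simp
  also have "\<dots> = (\<Sum>R\<in>UNIV. \<Sum>S\<in>UNIV. lower_op (raise_op g) R S * g R S)"
    by (rule sum_raise_adjoint)
  also have "\<dots> = (\<Sum>R\<in>UNIV. \<Sum>S\<in>UNIV. g R S * raise_op (lower_op g) R S) +
      (\<Sum>R\<in>UNIV. \<Sum>S\<in>UNIV. (real (card S) - real (card R)) * (g R S * g R S))"
    unfolding lower_raise by (simp add: algebra_simps flip: sum.distrib)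
  also have "(\<Sum>R\<in>UNIV. \<Sum>S\<in>UNIV. g R S * raise_op (lower_op g) R S) =
      (\<Sum>R\<in>UNIV. \<Sum>S\<in>UNIV. lower_op g R S * lower_op g R S)"
    by (rule sum_raise_adjoint)
  finally have eq: "(\<Sum>R\<in>UNIV. \<Sum>S\<in>UNIV. lower_op g R S * lower_op g R S) +
      (\<Sum>R\<in>UNIV. \<Sum>S\<in>UNIV. (real (card S) - real (card R)) * (g R S * g R S)) = 0" by simp
  have nn: "0 \<le> (real (card S) - real (card R)) * (g R S * g R S)" for R S
    using supp[of R S] by (cases "g R S = 0") auto
  have "(\<Sum>R\<in>UNIV. \<Sum>S\<in>UNIV. lower_op g R S * lower_op g R S) \<ge> 0"
    by (intro sum_nonneg) simp
  moreover have "(\<Sum>R\<in>UNIV. \<Sum>S\<in>UNIV. (real (card S) - real (card R)) * (g R S * g R S)) \<ge> 0"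
    by (intro sum_nonneg nn)
  ultimately have "(\<Sum>R\<in>UNIV. \<Sum>S\<in>UNIV. (real (card S) - real (card R)) * (g R S * g R S)) = 0"
    using eq by linarith
  then have "(real (card S) - real (card R)) * (g R S * g R S) = 0"
    by (simp add: sum_nonneg_eq_0_iff sum_nonneg nn)
  then show ?thesis using supp[of R S] by (cases "g R S = 0") auto
qed

section \<open>The determinant as a wedge product\<close>

primrec wedge :: "'n::finite list \<Rightarrow> 'n set \<Rightarrow> real" where
  "wedge [] = (\<lambda>R. if R = {} then 1 else 0)"
| "wedge (x # xs) = create x (wedge xs)"

lemma wedge_swap_adjacent: "wedge (ps @ x # y # zs) R = - wedge (ps @ y # x # zs) R"
proof (induction ps arbitrary: R)
  case Nil
  show ?case by (simp add: create_create[of x y])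
next
  case (Cons p ps)
  then show ?case by (simp add: create_def)
qed

lemma wedge_move: "wedge (ps @ x # ys @ zs) R = (- 1) ^ length ys * wedge (ps @ ys @ x # zs) R"
proof (induction ys arbitrary: ps)
  case (Cons y ys)
  have "wedge (ps @ x # (y # ys) @ zs) R = - wedge ((ps @ [y]) @ x # ys @ zs) R"
    using wedge_swap_adjacent[of ps x y "ys @ zs"] by simp
  then show ?case using Cons.IH[of "ps @ [y]"] by simp
qed simp

lemma wedge_exchange: "wedge (ps @ x # ys @ y # zs) R = - wedge (ps @ y # ys @ x # zs) R"
proof -
  have "wedge (ps @ x # ys @ y # zs) R = (- 1) ^ length ys * wedge ((ps @ ys) @ x # y # zs) R"
    by (simp add: wedge_move)
  also have "\<dots> = - ((- 1) ^ length ys * wedge (ps @ ys @ y # x # zs) R)"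
    by (subst wedge_swap_adjacent) simp
  also have "\<dots> = - wedge (ps @ y # ys @ x # zs) R"
    by (simp add: wedge_move)
  finally show ?thesis .
qed

lemma wedge_nonzeroD: "wedge xs R \<noteq> 0 \<Longrightarrow> distinct xs \<and> set xs = R"
proof (induction xs arbitrary: R)
  case (Cons x xs)
  then have "x \<in> R" "wedge xs (R - {x}) \<noteq> 0" by (auto simp: create_def split: if_splits)
  with Cons.IH[of "R - {x}"] show ?case by auto
qed (auto split: if_splits)

lemma wedge_nonzero: "distinct xs \<Longrightarrow> wedge xs (set xs) \<noteq> 0"
  by (induction xs) (auto simp: create_def)

text \<open>\<open>L\<close> lists every label once, so transposing two labels exchanges exactly two
  entries of the mapped list.\<close>

lemma wedge_map_transpose:
  fixes L :: "'n::finite list"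
  assumes L: "distinct L" "set L = UNIV" and ab: "a \<noteq> b"
  shows "wedge (map (J \<circ> Transposition.transpose a b) L) R = - wedge (map J L) R"
proof -
  have main: "wedge (map (J \<circ> Transposition.transpose a b) L) R = - wedge (map J L) R"
    if eq: "L = ps @ a # ys @ b # zs" and ab: "a \<noteq> b" for a b ps ys zs
  proof -
    have 1: "map (J \<circ> Transposition.transpose a b) qs = map J qs" if "a \<notin> set qs" "b \<notin> set qs" for qs
    proof (rule map_cong[OF refl])
      fix x assume "x \<in> set qs"
      then have "x \<noteq> a" "x \<noteq> b" using that by auto
      then show "(J \<circ> Transposition.transpose a b) x = J x" by (simp add: transpose_apply_other)
    qed
    have "a \<notin> set ps" "b \<notin> set ps" "a \<notin> set ys" "b \<notin> set ys" "a \<notin> set zs" "b \<notin> set zs"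
      using L(1) eq by auto
    then show ?thesis
      using wedge_exchange[of "map J ps" "J b" "map J ys" "J a" "map J zs" R] eq
      by (simp add: 1 del: map_eq_conv)
  qed
  obtain ps qs where pq: "L = ps @ a # qs" by (metis L(2) UNIV_I split_list)
  then have "b \<in> set ps \<or> b \<in> set qs" using L(2) ab by auto
  then show ?thesis
  proof
    assume "b \<in> set qs"
    then obtain ys zs where "qs = ys @ b # zs" by (metis split_list)
    then show ?thesis using main pq ab by blast
  next
    assume "b \<in> set ps"
    then obtain xs ys where "ps = xs @ b # ys" by (metis split_list)
    then have "L = xs @ b # ys @ a # qs" using pq by simp
    then show ?thesis using main[of xs b ys a qs] ab by (simp add: transpose_commute)
  qed
qed

lemma wedge_map_permutes:
  fixes L :: "'n::finite list"
  assumes L: "distinct L" "set L = UNIV" and p: "p permutes UNIV"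
  shows "wedge (map p L) UNIV = of_int (sign p) * wedge L UNIV"
  using finite p
proof (induction p rule: permutes_rev_induct)
  case id
  then show ?case by (simp add: sign_id)
next
  case (swap a b p)
  have perm: "permutation p" using swap by (intro permutes_imp_permutation[of UNIV]) auto
  show ?case
  proof (cases "a = b")
    case True
    then show ?thesis using swap by simp
  next
    case False
    then have "wedge (map (p \<circ> Transposition.transpose a b) L) UNIV = - wedge (map p L) UNIV"
      by (rule wedge_map_transpose[OF L])
    moreover have "sign (p \<circ> Transposition.transpose a b) = - sign p"
      using False perm by (simp add: sign_compose permutation_swap_id sign_swap_id)
    ultimately show ?thesis using swap by (simp only: of_int_minus mult_minus_left)
  qed
qed

lemma prod_of_bool: "finite A \<Longrightarrow> (\<Prod>x\<in>A. if P x then 1 else 0 :: 'a::comm_semiring_1) = (if \<forall>x\<in>A. P x then 1 else 0)"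
  by (induction A rule: finite_induct) auto

lemma det_tensor_eq:
  "(det_tensor :: ('k::field, 'n::finite, 'n) tensor) J = (if J permutes UNIV then of_int (sign J) else 0)"
proof -
  have "pure_tensor (\<lambda>j. axis (\<pi> j) 1) J = (if \<pi> = J then 1 else 0 :: 'k)" for \<pi> :: "'n \<Rightarrow> 'n"
    unfolding pure_tensor_def axis_def by (auto simp: prod_of_bool fun_eq_iff eq_commute)
  then have "(det_tensor :: ('k, 'n, 'n) tensor) J =
      (\<Sum>\<pi> | \<pi> permutes (UNIV :: 'n set). if \<pi> = J then of_int (sign \<pi>) else 0)"
    unfolding det_tensor_def by (intro sum.cong) auto
  then show ?thesis by simp
qed

text \<open>\<open>L\<close> fixes an order of the tensor factors, and \<open>wedge L UNIV\<close>
  is its sign against the order by \<open>to_nat\<close>. If \<open>J\<close> is not a permutation,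
  it misses some index and both sides vanish.\<close>

lemma wedge_det_tensor:
  fixes L :: "'n::finite list"
  assumes L: "distinct L" "set L = UNIV"
  shows "wedge (map J L) UNIV = wedge L UNIV * det_tensor J"
proof (cases "J permutes UNIV")
  case True
  then show ?thesis by (simp add: wedge_map_permutes[OF L] det_tensor_eq)
next
  case False
  have "wedge (map J L) UNIV = 0"
  proof (rule ccontr)
    assume "wedge (map J L) UNIV \<noteq> 0"
    then have "J ` UNIV = UNIV" using wedge_nonzeroD[of "map J L" UNIV] L by simp
    then have "bij J" by (simp add: bij_def finite_UNIV_surj_inj)
    then show False using False by (auto intro: bij_imp_permutes) 
  qed
  then show ?thesis using False by (simp add: det_tensor_eq)
qed

section \<open>Underdetermined homogeneous linear systems\<close>

lemma homogeneous_system: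
  fixes M :: "'b \<Rightarrow> 'a \<Rightarrow> real"
  assumes "finite B" "finite A" "card B < card A"
  shows "\<exists>x. (\<exists>s\<in>A. x s \<noteq> 0) \<and> (\<forall>s. s \<notin> A \<longrightarrow> x s = 0) \<and> (\<forall>b\<in>B. (\<Sum>s\<in>A. M b s * x s) = 0)"
  using assms
proof (induction B arbitrary: A M rule: finite_induct)
  case empty
  then obtain p where "p \<in> A" by fastforce
  then show ?case by (intro exI[of _ "\<lambda>s. if s = p then 1 else 0"]) auto
next
  case (insert b B)
  show ?case
  proof (cases "\<forall>s\<in>A. M b s = 0")
    case True
    have "card B < card A" using insert by simp
    then obtain x where "(\<exists>s\<in>A. x s \<noteq> 0) \<and> (\<forall>s. s \<notin> A \<longrightarrow> x s = 0) \<and> (\<forall>b\<in>B. (\<Sum>s\<in>A. M b s * x s) = 0)"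
      using insert.IH insert.prems by blast
    then show ?thesis using True by (intro exI[of _ x]) simp
  next
    case False
    then obtain p where p: "p \<in> A" "M b p \<noteq> 0" by blast
    \<comment> \<open>Gaussian elimination: equation \<open>b\<close> expresses the unknown at the
      pivot \<open>p\<close> through the others and is substituted into the remaining
      equations.\<close>
    define A' where "A' = A - {p}"
    have A': "finite A'" "p \<notin> A'" "A = insert p A'" using p insert.prems by (auto simp: A'_def)
    have "card B < card A'" using insert A' by simp
    then obtain x where x: "\<exists>s\<in>A'. x s \<noteq> 0" "\<And>s. s \<notin> A' \<Longrightarrow> x s = 0"
      "\<And>c. c \<in> B \<Longrightarrow> (\<Sum>s\<in>A'. (M c s - M c p * M b s / M b p) * x s) = 0"
      using insert.IH[of A' "\<lambda>c s. M c s - M c p * M b s / M b p"] A' by auto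
    define y where "y = x(p := - (\<Sum>s\<in>A'. M b s * x s) / M b p)"
    have y: "(\<Sum>s\<in>A. M c s * y s) = M c p * y p + (\<Sum>s\<in>A'. M c s * x s)" for c
    proof -
      have "(\<Sum>s\<in>A'. M c s * y s) = (\<Sum>s\<in>A'. M c s * x s)"
        by (rule sum.cong) (use A' in \<open>auto simp: y_def\<close>)
      then show ?thesis using A' by simp
    qed
    show ?thesis
    proof (intro exI[of _ y] conjI ballI)
      show "\<exists>s\<in>A. y s \<noteq> 0" using x(1) A' by (auto simp: y_def)
      show "\<forall>s. s \<notin> A \<longrightarrow> y s = 0" using x(2) A' by (auto simp: y_def)
      fix c assume c: "c \<in> insert b B"
      show "(\<Sum>s\<in>A. M c s * y s) = 0"
      proof (cases "c = b")
        case True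
        then show ?thesis unfolding y using p by (simp add: y_def)
      next
        case False
        then have "(\<Sum>s\<in>A'. (M c s - M c p * M b s / M b p) * x s) = 0" using c x(3) by blast
        moreover have "(\<Sum>s\<in>A'. (M c s - M c p * M b s / M b p) * x s) =
            (\<Sum>s\<in>A'. M c s * x s) - M c p / M b p * (\<Sum>s\<in>A'. M b s * x s)"
          by (simp add: sum_subtractf sum_distrib_left algebra_simps)
        ultimately show ?thesis unfolding y by (simp add: y_def)
      qed
    qed
  qed
qed

section \<open>Koszul flattening\<close>

text \<open>\<open>t k\<close> indexes a basis vector of the exterior power in column \<open>k\<close>; the register \<open>R\<close> collects
  the wedge product of the indices contracted out of the first \<open>k\<close> columns.\<close>

primrec koszul :: "((nat \<Rightarrow> 'n::finite set) \<Rightarrow> real) \<Rightarrow> nat \<Rightarrow> 'n set \<Rightarrow> (nat \<Rightarrow> 'n set) \<Rightarrow> real" where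
  "koszul a 0 R t = (if R = {} then a t else 0)"
| "koszul a (Suc k) R t = raise_op (\<lambda>R S. koszul a k R (t(k := S))) R (t k)"

text \<open>The head is contracted last and in the highest column, so that the list is read in the
  same order as in \<open>wedge\<close>, where the head is also multiplied last.\<close>

primrec contract_list :: "((nat \<Rightarrow> 'n::finite set) \<Rightarrow> real) \<Rightarrow> 'n list \<Rightarrow> (nat \<Rightarrow> 'n set) \<Rightarrow> real" where
  "contract_list a [] t = a t"
| "contract_list a (x # xs) t =
     annih x (\<lambda>S. contract_list a xs (t(length xs := S))) (t (length xs))"

definition contract :: "nat \<Rightarrow> ('n::finite \<Rightarrow> real) \<Rightarrow> ((nat \<Rightarrow> 'n set) \<Rightarrow> real) \<Rightarrow> (nat \<Rightarrow> 'n set) \<Rightarrow> real" where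
  "contract k u b t = (\<Sum>x\<in>UNIV. u x * annih x (\<lambda>S. b (t(k := S))) (t k))"

primrec contracts :: "((nat \<Rightarrow> 'n::finite set) \<Rightarrow> real) \<Rightarrow> (nat \<Rightarrow> 'n \<Rightarrow> real) \<Rightarrow> nat \<Rightarrow> (nat \<Rightarrow> 'n set) \<Rightarrow> real" where
  "contracts a u 0 = a"
| "contracts a u (Suc k) = contract k (u k) (contracts a u k)"

text \<open>A coordinate of the pure tensor of the vectors \<open>u k\<close>; columns are counted
  from the end of the list, as in \<open>contract_list\<close>.\<close>

primrec weight :: "(nat \<Rightarrow> 'n \<Rightarrow> real) \<Rightarrow> 'n list \<Rightarrow> real" where
  "weight u [] = 1"
| "weight u (x # xs) = u (length xs) x * weight u xs"

lemma sum_lists_Suc: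
  fixes f :: "'n::finite list \<Rightarrow> real"
  shows "(\<Sum>xs | length xs = Suc k. f xs) = (\<Sum>x\<in>UNIV. \<Sum>xs | length xs = k. f (x # xs))"
proof -
  have "(\<Sum>x\<in>UNIV. \<Sum>xs | length xs = k. f (x # xs)) = (\<Sum>(x, xs)\<in>UNIV \<times> {xs. length xs = k}. f (x # xs))"
    by (rule sum.cartesian_product)
  also have "\<dots> = (\<Sum>xs | length xs = Suc k. f xs)"
    by (rule sum.reindex_bij_witness[where i = "\<lambda>xs. (hd xs, tl xs)" and j = "\<lambda>(x, xs). x # xs"])
       (auto simp: length_Suc_conv)
  finally show ?thesis ..
qed

text \<open>Every list of contracted indices leaves its wedge product in the register. Comparison
  with \<open>contracts_eq_sum\<close> shows that replacing the wedge coefficients by a pure tensor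
  turns the flattening into successive contractions.\<close>

lemma koszul_eq_sum:
  "koszul a k R t = (\<Sum>xs | length xs = k. wedge xs R * contract_list a xs t)"
proof (induction k arbitrary: R t)
  case 0
  then show ?case by simp
next
  case (Suc k)
  have "koszul a (Suc k) R t = (\<Sum>x\<in>UNIV. create x (\<lambda>R'. annih x (\<lambda>S. \<Sum>xs | length xs = k.
      wedge xs R' * contract_list a xs (t(k := S))) (t k)) R)"
    unfolding koszul.simps raise_op_def Suc.IH ..
  also have "\<dots> = (\<Sum>x\<in>UNIV. \<Sum>xs | length xs = k. create x (wedge xs) R *
      annih x (\<lambda>S. contract_list a xs (t(k := S))) (t k))"
    unfolding annih_sum create_sum by (intro sum.cong refl) (auto simp: create_def annih_def)
  also have "\<dots> = (\<Sum>xs | length xs = Suc k. wedge xs R * contract_list a xs t)"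
    unfolding sum_lists_Suc by (intro sum.cong refl) auto
  finally show ?case .
qed

lemma contracts_eq_sum:
  "contracts a u k t = (\<Sum>xs | length xs = k. weight u xs * contract_list a xs t)"
proof (induction k arbitrary: t)
  case 0
  then show ?case by simp
next
  case (Suc k)
  have "contracts a u (Suc k) t = (\<Sum>x\<in>UNIV. u k x * annih x (\<lambda>S. \<Sum>xs | length xs = k.
      weight u xs * contract_list a xs (t(k := S))) (t k))"
    unfolding contracts.simps contract_def Suc.IH ..
  also have "\<dots> = (\<Sum>x\<in>UNIV. \<Sum>xs | length xs = k. (u k x * weight u xs) *
      annih x (\<lambda>S. contract_list a xs (t(k := S))) (t k))"
    unfolding annih_sum sum_distrib_left by (intro sum.cong refl) (auto simp: annih_def)
  also have "\<dots> = (\<Sum>xs | length xs = Suc k. weight u xs * contract_list a xs t)"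
    unfolding sum_lists_Suc by (intro sum.cong refl) auto
  finally show ?case .
qed

text \<open>Each step adds one index to the register and takes one from its column; columns not yet
  treated keep their degrees.\<close>

lemma koszul_support:
  assumes a: "\<And>t k. a t \<noteq> 0 \<Longrightarrow> k < n \<Longrightarrow> card (t k) = Suc k"
    and "koszul a k R t \<noteq> 0"
  shows "card R = k \<and> (\<forall>m. k \<le> m \<and> m < n \<longrightarrow> card (t m) = Suc m)"
  using assms(2)
proof (induction k arbitrary: R t)
  case 0
  then show ?case using a by (auto split: if_splits)
next
  case (Suc k)
  from Suc.prems have "(\<Sum>x\<in>UNIV. create x (\<lambda>R'. annih x (\<lambda>S. koszul a k R' (t(k := S))) (t k)) R) \<noteq> 0"
    unfolding koszul.simps raise_op_def .
  then obtain x where x: "create x (\<lambda>R'. annih x (\<lambda>S. koszul a k R' (t(k := S))) (t k)) R \<noteq> 0"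
    by (rule sum.not_neutral_contains_not_neutral)
  then have xR: "x \<in> R" and "koszul a k (R - {x}) (t(k := insert x (t k))) \<noteq> 0"
    by (auto simp: create_def annih_def split: if_splits)
  then have "card (R - {x}) = k" "\<And>m. k \<le> m \<Longrightarrow> m < n \<Longrightarrow> card ((t(k := insert x (t k))) m) = Suc m"
    using Suc.IH by blast+
  moreover have "card R = Suc (card (R - {x}))"
    using xR by (metis card_Suc_Diff1 finite)
  moreover have "card (t m) = Suc m" if "Suc k \<le> m" "m < n" for m
    using calculation(2)[of m] that by simp
  ultimately show ?case by simp
qed

text \<open>Peel off one raising operator at a time. At step \<open>k\<close> the register has
  degree \<open>k\<close> and the column degree \<open>Suc k\<close>, which is the strict inequality
  that \<open>raise_injective\<close> asks for.\<close>

lemma koszul_injective: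
  assumes a: "\<And>t k. a t \<noteq> 0 \<Longrightarrow> k < n \<Longrightarrow> card (t k) = Suc k"
    and k: "k \<le> n" and zero: "\<And>R t. koszul a k R t = 0"
  shows "a t = 0"
  using k zero
proof (induction k arbitrary: t)
  case 0
  then show ?case by (metis koszul.simps(1))
next
  case (Suc k)
  have "koszul a k R t = 0" for R t
  proof -
    have "koszul a k R (t(k := t k)) = 0"
    proof (rule raise_injective[where g = "\<lambda>R S. koszul a k R (t(k := S))"])
      show "raise_op (\<lambda>R S. koszul a k R (t(k := S))) R S = 0" for R S
        using Suc.prems(2)[of R "t(k := S)"] by (simp only: koszul.simps fun_upd_same fun_upd_upd)
      show "card R < card S" if "koszul a k R (t(k := S)) \<noteq> 0" for R S
        using koszul_support[of a n k R "t(k := S)"] a that Suc.prems(1) by force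
    qed
    then show ?thesis by simp
  qed
  then show ?case using Suc by simp
qed

section \<open>Contraction of the columns with fixed vectors\<close>

lemma contract_contract_self: "contract k u (contract k u b) t = 0"
proof -
  have "contract k u (contract k u b) t =
      (\<Sum>x\<in>UNIV. \<Sum>y\<in>UNIV. u x * u y * annih x (annih y (\<lambda>S. b (t(k := S)))) (t k))"
    unfolding contract_def annih_sum sum_distrib_left
    by (intro sum.cong refl) (auto simp: annih_def)
  moreover have "(\<Sum>x\<in>UNIV. \<Sum>y\<in>UNIV. u x * u y * annih x (annih y (\<lambda>S. b (t(k := S)))) (t k))
      = - (\<Sum>x\<in>UNIV. \<Sum>y\<in>UNIV. u x * u y * annih x (annih y (\<lambda>S. b (t(k := S)))) (t k))"
    by (subst sum.swap, subst annih_annih) (simp add: sum_negf mult.commute)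
  ultimately show ?thesis by linarith
qed

lemma contract_commute:
  assumes "k \<noteq> l"
  shows "contract k u (contract l v b) t = contract l v (contract k u b) t"
proof -
  have "contract k u (contract l v b) t = (\<Sum>x\<in>UNIV. \<Sum>y\<in>UNIV. u x * v y *
     annih x (\<lambda>S. annih y (\<lambda>S'. b (t(k := S, l := S'))) (t l)) (t k))"
    unfolding contract_def annih_sum sum_distrib_left
    by (intro sum.cong refl) (use assms in \<open>auto simp: annih_def\<close>)
  also have "\<dots> = (\<Sum>y\<in>UNIV. \<Sum>x\<in>UNIV. v y * u x *
     annih y (\<lambda>S'. annih x (\<lambda>S. b (t(l := S', k := S))) (t k)) (t l))"
    by (subst sum.swap, intro sum.cong refl) (use assms in \<open>auto simp: annih_def fun_upd_twist\<close>)
  also have "\<dots> = contract l v (contract k u b) t"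
    unfolding contract_def annih_sum sum_distrib_left
    by (intro sum.cong refl) (use assms in \<open>auto simp: annih_def\<close>)
  finally show ?thesis .
qed

lemma contract_zero [simp]: "contract k u (\<lambda>t. 0) t = 0" "contract k (\<lambda>x. 0) b t = 0"
  by (auto simp: contract_def annih_def intro!: sum.neutral)

text \<open>Contractions in different columns commute and a repeated one vanishes. These are the
  equations fed into \<open>contract_kernel_eq_zero\<close>.\<close>

lemma contract_contracts: "k < n \<Longrightarrow> contract k (u k) (contracts a u n) t = 0"
proof (induction n arbitrary: t)
  case (Suc n)
  show ?case
  proof (cases "k = n")
    case True
    then show ?thesis by (simp add: contract_contract_self)
  next
    case False
    then have "contract k (u k) (contracts a u n) = (\<lambda>t. 0)" using Suc by auto
    then show ?thesis unfolding contracts.simps contract_commute[OF False] by simp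
  qed
qed simp

lemma contracts_zero: "k < n \<Longrightarrow> u k = (\<lambda>x. 0) \<Longrightarrow> contracts a u n t = 0"
proof (induction n arbitrary: t)
  case (Suc n)
  show ?case
  proof (cases "k = n")
    case False
    then have "contracts a u n = (\<lambda>t. 0)" using Suc by auto
    then show ?thesis by simp
  qed (use Suc in simp)
qed simp

lemma contracts_linear:
  assumes "finite A"
  shows "contracts (\<lambda>t. \<Sum>s\<in>A. f s t * c s) u n t = (\<Sum>s\<in>A. contracts (f s) u n t * c s)"
proof (induction n arbitrary: t)
  case (Suc n)
  have "contracts (\<lambda>t. \<Sum>s\<in>A. f s t * c s) u (Suc n) t =
      (\<Sum>x\<in>UNIV. \<Sum>s\<in>A. u n x * annih x (\<lambda>S. contracts (f s) u n (t(n := S))) (t n) * c s)"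
    unfolding contracts.simps contract_def Suc.IH annih_sum sum_distrib_left
    by (intro sum.cong refl) (auto simp: annih_def)
  also have "\<dots> = (\<Sum>s\<in>A. contracts (f s) u (Suc n) t * c s)"
    unfolding contracts.simps contract_def sum_distrib_right by (rule sum.swap)
  finally show ?case .
qed simp

lemma contracts_support:
  assumes a: "\<And>t k. a t \<noteq> 0 \<Longrightarrow> k < N \<Longrightarrow> card (t k) = Suc k" "\<And>t k. a t \<noteq> 0 \<Longrightarrow> N \<le> k \<Longrightarrow> t k = undefined"
    and "contracts a u n t \<noteq> 0" "n \<le> N"
  shows "(\<forall>k<N. card (t k) = (if k < n then k else Suc k)) \<and> (\<forall>k\<ge>N. t k = undefined)"
  using assms(3,4)
proof (induction n arbitrary: t)
  case 0
  then show ?case using a by auto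
next
  case (Suc n)
  from Suc.prems(1) have "(\<Sum>x\<in>UNIV. u n x * annih x (\<lambda>S. contracts a u n (t(n := S))) (t n)) \<noteq> 0"
    unfolding contracts.simps contract_def .
  then obtain x where "u n x * annih x (\<lambda>S. contracts a u n (t(n := S))) (t n) \<noteq> 0"
    by (rule sum.not_neutral_contains_not_neutral)
  then have x: "x \<notin> t n" and nz: "contracts a u n (t(n := insert x (t n))) \<noteq> 0"
    by (auto simp: annih_def split: if_splits)
  let ?t = "t(n := insert x (t n))"
  have IH: "\<And>k. k < N \<Longrightarrow> card (?t k) = (if k < n then k else Suc k)" "\<And>k. N \<le> k \<Longrightarrow> ?t k = undefined"
    using Suc.IH[OF nz] Suc.prems by auto
  have "card (t n) = n" using IH(1)[of n] x Suc.prems by simp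
  moreover have "card (t k) = (if k < n then k else Suc k)" if "k < N" "k \<noteq> n" for k
    using IH(1)[OF that(1)] that by simp
  moreover have "t k = undefined" if "N \<le> k" for k using IH(2)[OF that] Suc.prems that by (auto split: if_splits)
  ultimately show ?case by (metis less_Suc_eq)
qed

text \<open>A tensor of forms annihilated by a contraction with \<open>u k\<close> in every column is determined by
  its coordinates avoiding one index per column: solve the \<open>k\<close>-th equation for the coordinate
  containing \<open>p k\<close>.\<close>

lemma contract_kernel_eq_zero:
  assumes ker: "\<And>k t. k < n \<Longrightarrow> contract k (u k) b t = 0"
    and p: "\<And>k. k < n \<Longrightarrow> u k (p k) \<noteq> 0"
    and van: "\<And>t. (\<And>k. k < n \<Longrightarrow> p k \<notin> t k) \<Longrightarrow> b t = 0"
  shows "b t = 0"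
proof (induction "card {k. k < n \<and> p k \<in> t k}" arbitrary: t rule: less_induct)
  case less
  show ?case
  proof (cases "\<forall>k<n. p k \<notin> t k")
    case True
    then show ?thesis by (intro van) auto
  next
    case False
    then obtain k where k: "k < n" "p k \<in> t k" by blast
    let ?S = "t k - {p k}"
    have "b (t(k := insert x ?S)) = 0" if x: "x \<noteq> p k" for x
    proof (rule less)
      have "{l. l < n \<and> p l \<in> (t(k := insert x ?S)) l} \<subset> {l. l < n \<and> p l \<in> t l}"
        using k x by auto
      then show "card {l. l < n \<and> p l \<in> (t(k := insert x ?S)) l} < card {l. l < n \<and> p l \<in> t l}"
        by (intro psubset_card_mono) auto
    qed
    then have "u k x * annih x (\<lambda>S. b (t(k := S))) ?S = 0" if "x \<noteq> p k" for x
      using that by (simp add: annih_def)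
    then have "(\<Sum>x\<in>UNIV - {p k}. u k x * annih x (\<lambda>S. b (t(k := S))) ?S) = 0"
      by (intro sum.neutral) blast
    then have "(\<Sum>x\<in>UNIV. u k x * annih x (\<lambda>S. b (t(k := S))) ?S)
        = u k (p k) * annih (p k) (\<lambda>S. b (t(k := S))) ?S"
      by (simp add: sum.remove[of UNIV "p k"])
    moreover have "(\<Sum>x\<in>UNIV. u k x * annih x (\<lambda>S. b (t(k := S))) ?S) = 0"
      using ker[OF k(1), of "t(k := ?S)"] by (simp add: contract_def)
    moreover have "annih (p k) (\<lambda>S. b (t(k := S))) ?S = fsgn (p k) (t k) * b t"
      using k by (simp add: annih_def insert_absorb)
    ultimately show ?thesis using p[OF k(1)] by simp
  qed
qed

lemma weight_map:
  assumes "\<And>k. k < length Q \<Longrightarrow> u k = f (rev Q ! k)"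
  shows "weight u (map J Q) = (\<Prod>j\<leftarrow>Q. f j (J j))"
  using assms
proof (induction Q)
  case (Cons q Q)
  have "u (length Q) = f q" using Cons.prems[of "length Q"] by (simp add: nth_append)
  moreover have "weight u (map J Q) = (\<Prod>j\<leftarrow>Q. f j (J j))"
    using Cons.prems by (intro Cons.IH) (force simp: nth_append)
  ultimately show ?case by simp
qed simp

lemma sum_lists_eq_sum_functions:
  fixes L :: "'n::finite list" and F :: "'n list \<Rightarrow> real"
  assumes L: "distinct L" "set L = UNIV"
  shows "(\<Sum>xs | length xs = CARD('n). F xs) = (\<Sum>J\<in>UNIV. F (map J L))"
proof -
  have len: "length L = CARD('n)" using L distinct_card by fastforce
  show ?thesis
  proof (rule sum.reindex_bij_witness[where j = "\<lambda>xs j. the (map_of (zip L xs) j)" and i = "\<lambda>J. map J L"])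
    fix xs :: "'n list" assume "xs \<in> {xs. length xs = CARD('n)}"
    then show "map (\<lambda>j. the (map_of (zip L xs) j)) L = xs"
      using len L by (intro nth_equalityI) (auto simp: map_of_zip_nth)
    then show "F (map (\<lambda>j. the (map_of (zip L xs) j)) L) = F xs" by simp
  next
    fix J :: "'n \<Rightarrow> 'n"
    show "(\<lambda>j. the (map_of (zip L (map J L)) j)) = J"
      using L by (auto simp: map_of_zip_map)
  qed (use len in auto)
qed

lemma card_subsets_avoiding: "card {S :: 'n::finite set. card S = k \<and> p \<notin> S} = (CARD('n) - 1) choose k"
proof -
  have "{S :: 'n set. card S = k \<and> p \<notin> S} = {S. S \<subseteq> UNIV - {p} \<and> card S = k}" by auto
  then show ?thesis using n_subsets[of "UNIV - {p}" k] by simp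
qed

text \<open>If the inequality failed, there would be fewer equations than coordinates of a tensor
  \<open>a\<close> of forms with degree \<open>Suc k\<close> in column \<open>k\<close>. The
  equations make each of the \<open>r\<close> contractions of \<open>a\<close> vanish at the
  coordinates avoiding one chosen index per column, hence everywhere. Then the flattening of a
  nonzero \<open>a\<close> vanishes, against injectivity.\<close>

lemma koszul_rank_bound:
  fixes v :: "nat \<Rightarrow> 'n::finite \<Rightarrow> real ^ 'n"
  assumes dec: "det_tensor = (\<lambda>I. \<Sum>i<r. pure_tensor (v i) I)"
  shows "(\<Prod>k<CARD('n). CARD('n) choose Suc k) \<le> r * (\<Prod>k<CARD('n). (CARD('n) - 1) choose k)"
proof (rule ccontr)
  define n where "n = CARD('n)"
  assume "\<not> ?thesis"
  then have less: "r * (\<Prod>k<n. (n - 1) choose k) < (\<Prod>k<n. n choose Suc k)" by (simp add: n_def)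
  obtain L :: "'n list" where L: "distinct L" "set L = UNIV"
    using finite_distinct_list[of "UNIV :: 'n set"] by auto
  have len: "length L = n" using L distinct_card unfolding n_def by fastforce
  define u where "u i k x = v i (rev L ! k) $ x" for i k x
  \<comment> \<open>A nonzero entry of each vector, to be avoided in its column. For a zero vector
    the choice is arbitrary, but then the whole contraction is zero.\<close>
  define p where "p i k = (SOME x. u i k x \<noteq> 0)" for i k
  define A where "A = (\<Pi>\<^sub>E k\<in>{..<n}. {S :: 'n set. card S = Suc k})"
  define B where "B i = (\<Pi>\<^sub>E k\<in>{..<n}. {S :: 'n set. card S = k \<and> p i k \<notin> S})" for i
  have finA: "finite A" unfolding A_def by (intro finite_PiE) auto
  have finB: "finite (B i)" for i unfolding B_def by (intro finite_PiE) auto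
  have "card A = (\<Prod>k<n. n choose Suc k)"
    unfolding A_def n_def using n_subsets[of "UNIV :: 'n set"] by (simp add: card_PiE)
  moreover have "card (B i) = (\<Prod>k<n. (n - 1) choose k)" for i
    unfolding B_def n_def by (simp add: card_PiE card_subsets_avoiding)
  then have "card (Sigma {..<r} B) = r * (\<Prod>k<n. (n - 1) choose k)"
    by (simp add: card_SigmaI finB)
  ultimately have "card (Sigma {..<r} B) < card A" using less by simp
  moreover have "finite (Sigma {..<r} B)" using finB by blast
  ultimately obtain a where a: "\<exists>s\<in>A. a s \<noteq> 0" "\<And>s. s \<notin> A \<Longrightarrow> a s = 0"
    "\<And>i t. i < r \<Longrightarrow> t \<in> B i \<Longrightarrow>
      (\<Sum>s\<in>A. contracts (\<lambda>t. if t = s then 1 else 0) (u i) n t * a s) = 0"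
    using homogeneous_system[of "Sigma {..<r} B" A
        "\<lambda>(i, t) s. contracts (\<lambda>t. if t = s then 1 else 0) (u i) n t"] finA by auto
  have a_supp: "card (t k) = Suc k" if "a t \<noteq> 0" "k < n" for t k
    using a(2)[of t] that by (fastforce simp: A_def)
  have a_ext: "t k = undefined" if "a t \<noteq> 0" "n \<le> k" for t k
    using a(2)[of t] that PiE_arb[of t "{..<n}" _ k] unfolding A_def by (metis lessThan_iff not_less)
  have a_eq: "a = (\<lambda>t. \<Sum>s\<in>A. (if t = s then 1 else 0) * a s)"
  proof
    fix t
    have "(\<Sum>s\<in>A. (if t = s then 1 else 0) * a s) = (\<Sum>s\<in>A. if t = s then a s else 0)"
      by (rule sum.cong) auto
    then show "a t = (\<Sum>s\<in>A. (if t = s then 1 else 0) * a s)" using a(2)[of t] finA by simp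
  qed
  have zero: "contracts a (u i) n t = 0" if i: "i < r" for i t
  proof (cases "\<exists>k<n. u i k = (\<lambda>x. 0)")
    case True
    then show ?thesis using contracts_zero by metis
  next
    case False
    then have p: "u i k (p i k) \<noteq> 0" if "k < n" for k
      unfolding p_def using that by (intro someI_ex[of "\<lambda>x. u i k x \<noteq> 0"]) (auto simp: fun_eq_iff)
    show ?thesis
    proof (rule contract_kernel_eq_zero[where p = "p i" and u = "u i" and n = n])
      fix t assume t: "\<And>k. k < n \<Longrightarrow> p i k \<notin> t k"
      show "contracts a (u i) n t = 0"
      proof (rule ccontr)
        assume nz: "contracts a (u i) n t \<noteq> 0"
        then have "(\<forall>k<n. card (t k) = k) \<and> (\<forall>k\<ge>n. t k = undefined)"
          using contracts_support[of a n "u i" n t] a_supp a_ext by simp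
        then have "t \<in> B i" using t by (auto simp: B_def PiE_iff extensional_def)
        then have "(\<Sum>s\<in>A. contracts (\<lambda>t. if t = s then 1 else 0) (u i) n t * a s) = 0"
          using a(3) i by blast
        moreover have "contracts a (u i) n t = (\<Sum>s\<in>A. contracts (\<lambda>t. if t = s then 1 else 0) (u i) n t * a s)"
          using contracts_linear[OF finA, of "\<lambda>s t. if t = s then 1 else 0" a "u i" n t]
          by (simp only: a_eq[symmetric])
        ultimately show False using nz by simp
      qed
    qed (use p contract_contracts in auto)
  qed
  have "koszul a n R t = 0" for R t
  proof (cases "R = UNIV")
    case False
    then have "card R \<noteq> n" unfolding n_def by (metis card_subset_eq finite subset_UNIV)
    then show ?thesis using koszul_support[of a n n R t] a_supp by blast
  next
    case True
    have w: "weight (u i) (map J L) = pure_tensor (v i) J" for i J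
    proof -
      have "weight (u i) (map J L) = (\<Prod>j\<leftarrow>L. v i j $ J j)"
        by (rule weight_map[where f = "\<lambda>j x. v i j $ x"]) (auto simp: u_def fun_eq_iff)
      also have "\<dots> = (\<Prod>j\<in>set L. v i j $ J j)" by (rule prod.distinct_set_conv_list[OF L(1), symmetric])
      finally show ?thesis using L(2) by (simp add: pure_tensor_def)
    qed
    have "koszul a n UNIV t = (\<Sum>J\<in>UNIV. wedge (map J L) UNIV * contract_list a (map J L) t)"
      unfolding koszul_eq_sum n_def by (rule sum_lists_eq_sum_functions[OF L])
    also have "\<dots> = (\<Sum>J\<in>UNIV. \<Sum>i<r. wedge L UNIV * (weight (u i) (map J L) * contract_list a (map J L) t))"
      by (simp add: wedge_det_tensor[OF L] dec w sum_distrib_left sum_distrib_right mult.assoc)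
    also have "\<dots> = (\<Sum>i<r. wedge L UNIV * (\<Sum>J\<in>UNIV. weight (u i) (map J L) * contract_list a (map J L) t))"
      by (subst sum.swap) (simp add: sum_distrib_left)
    also have "\<dots> = (\<Sum>i<r. wedge L UNIV * contracts a (u i) n t)"
      unfolding contracts_eq_sum n_def
      by (simp add: sum_lists_eq_sum_functions[OF L, where F = "\<lambda>xs. weight (u i) xs * contract_list a xs t" for i])
    also have "\<dots> = 0" using zero by simp
    finally show ?thesis using True by simp
  qed
  then have "a t = 0" for t
    using koszul_injective[of a n n t] a_supp by blast
  then show False using a(1) by blast
qed

section \<open>Decompositions and tensor rank\<close>

lemma pure_tensor_scale:
  fixes v :: "'m::finite \<Rightarrow> 'k::field ^ 'd"
  shows "\<exists>w. \<forall>I. pure_tensor w I = c * pure_tensor v I"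
proof -
  \<comment> \<open>Some factor exists because types are nonempty; it absorbs the scalar.\<close>
  fix j :: 'm
  define w where "w = v(j := (\<chi> d. c * v j $ d))"
  have "pure_tensor w I = c * pure_tensor v I" for I
  proof -
    have "(\<Prod>l\<in>UNIV - {j}. w l $ I l) = (\<Prod>l\<in>UNIV - {j}. v l $ I l)"
      by (rule prod.cong) (auto simp: w_def)
    then show ?thesis
      unfolding pure_tensor_def by (simp add: prod.remove[of UNIV j] w_def mult.assoc)
  qed
  then show ?thesis by blast
qed

lemma ex_pure_tensor_sum:
  assumes "finite X" and T: "T = (\<lambda>I. \<Sum>x\<in>X. c x * pure_tensor (v x) I)"
  shows "\<exists>w. T = (\<lambda>I. \<Sum>i<card X. pure_tensor (w i) I)"
proof -
  obtain e where e: "bij_betw e {..<card X} X"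
    using ex_bij_betw_nat_finite[OF \<open>finite X\<close>] by (auto simp: atLeast0LessThan)
  have "\<forall>i. \<exists>w. \<forall>I. pure_tensor w I = c (e i) * pure_tensor (v (e i)) I"
    using pure_tensor_scale by blast
  from choice[OF this] obtain w where w: "\<And>i I. pure_tensor (w i) I = c (e i) * pure_tensor (v (e i)) I"
    by blast
  have "T = (\<lambda>I. \<Sum>i<card X. pure_tensor (w i) I)"
    unfolding T w by (intro ext) (rule sum.reindex_bij_betw[OF e, symmetric])
  then show ?thesis by blast
qed

lemma tensor_rank_le:
  assumes "finite X" and "T = (\<lambda>I. \<Sum>x\<in>X. c x * pure_tensor (v x) I)"
  shows "tensor_rank T \<le> card X"
  unfolding tensor_rank_def using ex_pure_tensor_sum[OF assms] by (rule Least_le)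

lemma tensor_rank_decomposition:
  assumes "finite X" and "T = (\<lambda>I. \<Sum>x\<in>X. c x * pure_tensor (v x) I)"
  shows "\<exists>w. T = (\<lambda>I. \<Sum>i<tensor_rank T. pure_tensor (w i) I)"
  unfolding tensor_rank_def using ex_pure_tensor_sum[OF assms] by (rule LeastI)

text \<open>With \<open>n = Suc m\<close>, multiplying
  \<open>Suc k * (n choose Suc k) = n * (m choose k)\<close> over all \<open>k < n\<close> turns the
  quotient of the two products of binomials into n^n / n!, which is the stated bound.\<close>

lemma det_tensor_rank_lower_bound:
  "real (CARD('n) ^ (CARD('n) - 1)) / fact (CARD('n) - 1)
     \<le> real (tensor_rank (det_tensor :: (real, 'n::finite, 'n) tensor))"
proof -
  define r where "r = tensor_rank (det_tensor :: (real, 'n, 'n) tensor)"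
  obtain m where m: "CARD('n) = Suc m" by (metis not0_implies_Suc zero_less_card_finite less_numeral_extra(3))
  have "\<exists>w. (det_tensor :: (real, 'n, 'n) tensor) = (\<lambda>I. \<Sum>i<r. pure_tensor (w i) I)"
    unfolding r_def
    by (rule tensor_rank_decomposition[where X = "{\<pi>. \<pi> permutes (UNIV :: 'n set)}"])
       (auto simp: det_tensor_def finite_permutations)
  then obtain w where "(det_tensor :: (real, 'n, 'n) tensor) = (\<lambda>I. \<Sum>i<r. pure_tensor (w i) I)" ..
  then have "(\<Prod>k<Suc m. Suc m choose Suc k) \<le> r * (\<Prod>k<Suc m. m choose k)"
    using koszul_rank_bound[where r = r and v = w] m by simp
  moreover have "fact (Suc m) * (\<Prod>k<Suc m. Suc m choose Suc k) = Suc m ^ Suc m * (\<Prod>k<Suc m. m choose k)"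
  proof -
    have "fact (Suc m) = (\<Prod>k<Suc m. Suc k)"
      unfolding fact_prod_Suc by (simp add: atLeast0LessThan)
    then have "fact (Suc m) * (\<Prod>k<Suc m. Suc m choose Suc k) = (\<Prod>k<Suc m. Suc k * (Suc m choose Suc k))"
      by (simp only: prod.distrib)
    also have "\<dots> = (\<Prod>k<Suc m. Suc m * (m choose k))"
      by (simp only: Suc_times_binomial)
    finally show ?thesis by (simp only: prod.distrib prod_constant card_lessThan)
  qed
  ultimately have "Suc m ^ Suc m * (\<Prod>k<Suc m. m choose k) \<le> fact (Suc m) * r * (\<Prod>k<Suc m. m choose k)"
    by (metis mult.assoc mult_le_mono2)
  moreover have "0 < (\<Prod>k<Suc m. m choose k)" by (intro prod_pos) (auto simp: zero_less_binomial)
  ultimately have "Suc m ^ Suc m \<le> fact (Suc m) * r" using mult_le_cancel2 by blast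
  then have "Suc m * Suc m ^ m \<le> Suc m * (fact m * r)" by (simp only: fact_Suc power_Suc mult.assoc of_nat_id)
  then have "Suc m ^ m \<le> fact m * r" using mult_le_cancel1 by (metis zero_less_Suc)
  then have "real (Suc m ^ m) \<le> fact m * real r" by (metis of_nat_fact of_nat_le_iff of_nat_mult)
  then show ?thesis using m by (simp add: r_def field_simps)
qed

section \<open>Cup products on the cubical grid\<close>

text \<open>A point \<open>c\<close> stands for the cubical face with centre \<open>c\<close> of the grid with vertices \<open>2\<int>\<^sup>n\<close>: the face
  extends by \<open>\<plusminus>1\<close> exactly in the directions of its odd coordinates.\<close>

definition odd_coords :: "int ^ 'n \<Rightarrow> 'n set" where
  "odd_coords c = {i. odd (c $ i)}"

lemma odd_coords_shift:
  "odd_coords (c + axis i 1) = (if i \<in> odd_coords c then odd_coords c - {i} else insert i (odd_coords c))"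
  "odd_coords (c - axis i 1) = (if i \<in> odd_coords c then odd_coords c - {i} else insert i (odd_coords c))"
  by (auto simp: odd_coords_def axis_def split: if_splits)

text \<open>The cubical coboundary up to an overall sign. Cochains of all degrees are kept in one
  function of face centres; the two facets in an odd direction lie one unit to either side of the
  centre.\<close>

definition cobd :: "(int ^ 'n::finite \<Rightarrow> real) \<Rightarrow> int ^ 'n \<Rightarrow> real" where
  "cobd G c = (\<Sum>i\<in>odd_coords c. fsgn i (odd_coords c) * (G (c - axis i 1) - G (c + axis i 1)))"

lemma cobd_eq_create: "cobd G c = (\<Sum>i\<in>UNIV. create i (\<lambda>R. 1) (odd_coords c) * (G (c - axis i 1) - G (c + axis i 1)))"
  unfolding cobd_def by (rule sum.mono_neutral_cong_left) (auto simp: create_def)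

text \<open>The signs are antisymmetric in the two directions, whereas the second difference
  \<open>H\<close> is symmetric.\<close>

lemma cobd_cobd: "cobd (cobd G) c = 0"
proof -
  define H where "H i j = G (c - axis i 1 - axis j 1) - G (c - axis i 1 + axis j 1)
    - G (c + axis i 1 - axis j 1) + G (c + axis i 1 + axis j 1)" for i j
  have H: "H i j = H j i" for i j
    by (simp add: H_def algebra_simps)
  have "cobd (cobd G) c = (\<Sum>i\<in>odd_coords c. \<Sum>j\<in>UNIV. create i (create j (\<lambda>R. 1)) (odd_coords c) * H i j)"
    unfolding cobd_def[of "cobd G"] cobd_eq_create[of G]
    by (intro sum.cong refl)
       (simp add: odd_coords_shift create_def[of _ "create _ _"] H_def algebra_simps sum_distrib_left
          flip: sum_subtractf sum.distrib)
  also have "\<dots> = (\<Sum>i\<in>UNIV. \<Sum>j\<in>UNIV. create i (create j (\<lambda>R. 1)) (odd_coords c) * H i j)"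
    by (rule sum.mono_neutral_left) (auto simp: create_def[of _ "create _ _"])
  finally have eq: "cobd (cobd G) c = (\<Sum>i\<in>UNIV. \<Sum>j\<in>UNIV. create i (create j (\<lambda>R. 1)) (odd_coords c) * H i j)" .
  have "(\<Sum>i\<in>UNIV. \<Sum>j\<in>UNIV. create i (create j (\<lambda>R. 1)) (odd_coords c) * H i j)
      = (\<Sum>i\<in>UNIV. \<Sum>j\<in>UNIV. create j (create i (\<lambda>R. 1)) (odd_coords c) * H j i)"
    by (rule sum.swap)
  also have "\<dots> = - (\<Sum>i\<in>UNIV. \<Sum>j\<in>UNIV. create i (create j (\<lambda>R. 1)) (odd_coords c) * H i j)"
    unfolding sum_negf[symmetric]
    by (intro sum.cong refl) (metis H create_create mult_minus_left)
  finally show ?thesis unfolding eq by linarith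
qed

text \<open>\<open>\<Psi>\<close> assigns a value to every face centre, that is, to every vertex of
  the barycentric subdivision. Unfolded, this is the signed sum over flags of faces starting at
  \<open>c\<close> of the products of coordinate differences along the flag; the base case keeps the
  flags that end in a grid vertex.\<close>

primrec cup :: "(int ^ 'n::finite \<Rightarrow> real ^ 'n) \<Rightarrow> 'n list \<Rightarrow> int ^ 'n \<Rightarrow> real" where
  "cup \<Psi> [] = (\<lambda>c. if odd_coords c = {} then 1 else 0)"
| "cup \<Psi> (x # xs) = (\<lambda>c. \<Sum>i\<in>odd_coords c. fsgn i (odd_coords c) *
     ((\<Psi> c - \<Psi> (c - axis i 1)) $ x * cup \<Psi> xs (c - axis i 1) -
      (\<Psi> c - \<Psi> (c + axis i 1)) $ x * cup \<Psi> xs (c + axis i 1)))"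

text \<open>A Leibniz formula, obtained by separating the value of \<open>\<Psi>\<close> at the face
  from its value at the facet.\<close>

lemma cup_Cons_cobd:
  "cup \<Psi> (x # xs) c = \<Psi> c $ x * cobd (cup \<Psi> xs) c - cobd (\<lambda>c. \<Psi> c $ x * cup \<Psi> xs c) c"
  unfolding cup.simps cobd_def sum_distrib_left sum_subtractf[symmetric]
  by (intro sum.cong refl) (simp add: algebra_simps)

lemma cobd_uminus: "cobd (\<lambda>c. - f c) c = - cobd f c"
  unfolding cobd_def sum_negf[symmetric] by (intro sum.cong refl) (simp add: algebra_simps)

text \<open>By induction the first term of the Leibniz formula vanishes, so the product is a
  coboundary.\<close>

lemma cobd_cup: "cobd (cup \<Psi> xs) c = 0"
proof (induction xs arbitrary: c)
  case Nil
  show ?case unfolding cobd_def by (rule sum.neutral) (auto simp: odd_coords_shift)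
next
  case (Cons x xs)
  have "cup \<Psi> (x # xs) = (\<lambda>c. - cobd (\<lambda>c. \<Psi> c $ x * cup \<Psi> xs c) c)"
    by (intro ext) (simp only: cup_Cons_cobd Cons.IH mult_zero_right diff_0)
  then have "cobd (cup \<Psi> (x # xs)) c = - cobd (cobd (\<lambda>c. \<Psi> c $ x * cup \<Psi> xs c)) c"
    by (simp only: cobd_uminus)
  then show ?case by (simp add: cobd_cobd del: cup.simps)
qed

lemma cup_Cons: "cup \<Psi> (x # xs) c = - cobd (\<lambda>c. \<Psi> c $ x * cup \<Psi> xs c) c"
  unfolding cup_Cons_cobd cobd_cup by simp

section \<open>Periodic functions and summation over a period\<close>

definition scale_vec :: "int \<Rightarrow> int ^ 'n \<Rightarrow> int ^ 'n" where
  "scale_vec M g = (\<chi> i. M * g $ i)"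

definition periodic :: "int \<Rightarrow> (int ^ 'n \<Rightarrow> 'b) \<Rightarrow> bool" where
  "periodic M H \<longleftrightarrow> (\<forall>c g. H (c + scale_vec M g) = H c)"

definition period_box :: "int \<Rightarrow> (int ^ 'n) set" where
  "period_box M = {c. \<forall>i. 0 \<le> c $ i \<and> c $ i < M}"

lemma finite_period_box: "finite (period_box M :: (int ^ 'n::finite) set)"
proof (rule finite_subset)
  show "period_box M \<subseteq> (\<lambda>f. \<chi> i. f i) ` (\<Pi>\<^sub>E i\<in>(UNIV :: 'n set). {0..<M})"
  proof
    fix c :: "int ^ 'n" assume "c \<in> period_box M"
    then show "c \<in> (\<lambda>f. \<chi> i. f i) ` (\<Pi>\<^sub>E i\<in>(UNIV :: 'n set). {0..<M})"
      by (intro image_eqI[of _ _ "\<lambda>i. c $ i"]) (auto simp: period_box_def)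
  qed
  show "finite ((\<lambda>f. \<chi> i. f i) ` (\<Pi>\<^sub>E i\<in>(UNIV :: 'n set). {0..<M}))"
    by (intro finite_imageI finite_PiE) auto
qed

definition mod_vec :: "int ^ 'n \<Rightarrow> int \<Rightarrow> int ^ 'n" where
  "mod_vec c M = (\<chi> i. c $ i mod M)"

definition div_vec :: "int ^ 'n \<Rightarrow> int \<Rightarrow> int ^ 'n" where
  "div_vec c M = (\<chi> i. c $ i div M)"

lemma mod_div_vec: "mod_vec c M + scale_vec M (div_vec c M) = c"
  by (simp add: vec_eq_iff mod_vec_def div_vec_def scale_vec_def)

lemma mod_vec_in_box: "0 < M \<Longrightarrow> mod_vec c M \<in> period_box M"
  by (simp add: period_box_def mod_vec_def)

lemma mod_vec_add_scale: "0 < M \<Longrightarrow> mod_vec (c + scale_vec M g) M = mod_vec c M"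
  by (simp add: vec_eq_iff mod_vec_def scale_vec_def)

lemma div_vec_add_scale: "0 < M \<Longrightarrow> div_vec (c + scale_vec M g) M = div_vec c M + g"
  by (simp add: vec_eq_iff div_vec_def scale_vec_def)

lemma periodic_mod_vec: "periodic M H \<Longrightarrow> H (mod_vec c M) = H c"
  unfolding periodic_def by (metis mod_div_vec)

lemma sum_period_box_shift:
  fixes H :: "int ^ 'n::finite \<Rightarrow> real"
  assumes "0 < M" "periodic M H"
  shows "(\<Sum>c\<in>period_box M. H (c + v)) = (\<Sum>c\<in>period_box M. H c)"
proof (rule sum.reindex_bij_witness[where j = "\<lambda>c. mod_vec (c + v) M" and i = "\<lambda>c. mod_vec (c - v) M"])
  fix c :: "int ^ 'n" assume c: "c \<in> period_box M"
  show "mod_vec (mod_vec (c + v) M - v) M = c" "mod_vec (mod_vec (c - v) M + v) M = c"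
    using c assms(1) by (auto simp: vec_eq_iff mod_vec_def period_box_def mod_simps)
  show "H (mod_vec (c + v) M) = H (c + v)"
    by (rule periodic_mod_vec[OF assms(2)])
qed (use assms mod_vec_in_box in auto)

lemma odd_coords_periodic: "even M \<Longrightarrow> odd_coords (c + scale_vec M g) = odd_coords c"
  by (auto simp: odd_coords_def scale_vec_def)

text \<open>A unit step in direction \<open>i\<close> carries faces with directions \<open>D\<close>
  to faces with directions \<open>D - {i}\<close>, so lower and upper facets have the same total. An
  even period makes the parities periodic.\<close>

lemma sum_type_shift:
  fixes K :: "int ^ 'n::finite \<Rightarrow> real"
  assumes M: "0 < M" "even M" and K: "periodic M K" and i: "i \<in> D"
  shows "(\<Sum>c\<in>period_box M. if odd_coords c = D then K (c - axis i 1) else 0)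
           = (\<Sum>c\<in>period_box M. if odd_coords c = D - {i} then K c else 0)"
    and "(\<Sum>c\<in>period_box M. if odd_coords c = D then K (c + axis i 1) else 0)
           = (\<Sum>c\<in>period_box M. if odd_coords c = D - {i} then K c else 0)"
proof -
  define H where "H c = (if odd_coords c = D - {i} then K c else 0)" for c
  have "periodic M H" using K M by (simp add: periodic_def H_def odd_coords_periodic)
  then have sh: "(\<Sum>c\<in>period_box M. H (c + v)) = (\<Sum>c\<in>period_box M. H c)" for v
    by (rule sum_period_box_shift[OF M(1)])
  have "H (c + axis i 1) = (if odd_coords c = D then K (c + axis i 1) else 0)"
    and "H (c + - axis i 1) = (if odd_coords c = D then K (c - axis i 1) else 0)" for c
    using i by (auto simp: H_def odd_coords_shift)
  then show "(\<Sum>c\<in>period_box M. if odd_coords c = D then K (c - axis i 1) else 0)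
           = (\<Sum>c\<in>period_box M. if odd_coords c = D - {i} then K c else 0)"
    and "(\<Sum>c\<in>period_box M. if odd_coords c = D then K (c + axis i 1) else 0)
           = (\<Sum>c\<in>period_box M. if odd_coords c = D - {i} then K c else 0)"
    using sh[of "- axis i 1"] sh[of "axis i 1"] by (simp_all add: H_def)
qed

text \<open>Stokes' theorem on the discrete torus: in each direction the totals over lower and upper
  facets cancel.\<close>

lemma sum_cobd_periodic:
  fixes K :: "int ^ 'n::finite \<Rightarrow> real"
  assumes M: "0 < M" "even M" and K: "periodic M K"
  shows "(\<Sum>c\<in>period_box M. if odd_coords c = D then cobd K c else 0) = 0"
proof -
  have "(\<Sum>c\<in>period_box M. if odd_coords c = D then cobd K c else 0) =
     (\<Sum>c\<in>period_box M. \<Sum>i\<in>D. fsgn i D * ((if odd_coords c = D then K (c - axis i 1) else 0)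
        - (if odd_coords c = D then K (c + axis i 1) else 0)))"
    by (intro sum.cong refl) (simp add: cobd_def)
  also have "\<dots> = (\<Sum>i\<in>D. fsgn i D * ((\<Sum>c\<in>period_box M. if odd_coords c = D then K (c - axis i 1) else 0)
        - (\<Sum>c\<in>period_box M. if odd_coords c = D then K (c + axis i 1) else 0)))"
    by (subst sum.swap) (simp only: sum_distrib_left[symmetric] sum_subtractf)
  also have "\<dots> = 0"
    by (rule sum.neutral) (simp add: sum_type_shift[OF M K])
  finally show ?thesis .
qed

definition equivariant :: "int \<Rightarrow> (int ^ 'n \<Rightarrow> real ^ 'n) \<Rightarrow> bool" where
  "equivariant M \<Psi> \<longleftrightarrow> (\<forall>c g. \<Psi> (c + scale_vec M g) = \<Psi> c + lattice_vec g)"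

lemma cup_periodic:
  assumes "even M" "equivariant M \<Psi>"
  shows "periodic M (cup \<Psi> xs)"
proof (induction xs)
  case Nil
  then show ?case using assms by (simp add: periodic_def odd_coords_periodic)
next
  case (Cons x xs)
  have 1: "c + scale_vec M g - v = (c - v) + scale_vec M g" "c + scale_vec M g + v = (c + v) + scale_vec M g"
    for c v :: "int ^ 'a" and g by simp_all
  have 2: "\<Psi> (c + scale_vec M g) = \<Psi> c + lattice_vec g" for c g
    using assms(2) by (simp add: equivariant_def)
  have 3: "cup \<Psi> xs (c + scale_vec M g) = cup \<Psi> xs c" for c g
    using Cons by (simp add: periodic_def)
  show ?case
    unfolding periodic_def cup.simps 1 2 3 odd_coords_periodic[OF assms(1)] by simp
qed

definition cup_integral :: "int \<Rightarrow> (int ^ 'n::finite \<Rightarrow> real ^ 'n) \<Rightarrow> 'n list \<Rightarrow> 'n set \<Rightarrow> real" where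
  "cup_integral M \<Psi> xs D = (\<Sum>c\<in>period_box M. if odd_coords c = D then cup \<Psi> xs c else 0)"

text \<open>Replace \<open>\<Psi>\<close> by the linear map \<open>c / M\<close>: the difference is
  periodic and contributes the coboundary of a periodic function, whose sum is zero. For the linear
  part only direction \<open>x\<close> matters, and its two facets contribute \<open>1 / M\<close>
  each.\<close>

lemma cup_integral_Cons:
  assumes M: "0 < M" "even M" and \<Psi>: "equivariant M \<Psi>"
  shows "cup_integral M \<Psi> (x # xs) D = 2 / M * create x (cup_integral M \<Psi> xs) D"
proof -
  define \<theta> where "\<theta> c = \<Psi> c $ x - c $ x / M" for c
  let ?G = "cup \<Psi> xs"
  have G: "periodic M ?G" using cup_periodic M \<Psi> by blast
  have "\<theta> (c + scale_vec M g) = \<theta> c" for c g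
    using \<Psi> M by (simp add: \<theta>_def equivariant_def lattice_vec_def scale_vec_def field_simps)
  then have \<theta>G: "periodic M (\<lambda>c. \<theta> c * ?G c)" using G by (simp add: periodic_def)
  \<comment> \<open>The linear function changes only in direction \<open>x\<close>, by
    \<open>1 / M\<close> on either side; what remains is a multiple of the coboundary of the cocycle
    \<open>?G\<close>.\<close>
  have lin: "cobd (\<lambda>c. c $ x / M * ?G c) c =
      - (if x \<in> odd_coords c then fsgn x (odd_coords c) / M * (?G (c - axis x 1) + ?G (c + axis x 1)) else 0)" for c
  proof -
    have "cobd (\<lambda>c. c $ x / M * ?G c) c = (\<Sum>i\<in>odd_coords c. c $ x / M * (fsgn i (odd_coords c) * (?G (c - axis i 1) - ?G (c + axis i 1)))
        - (if i = x then fsgn x (odd_coords c) / M * (?G (c - axis x 1) + ?G (c + axis x 1)) else 0))"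
      unfolding cobd_def
      by (intro sum.cong refl) (auto simp: axis_def diff_divide_distrib add_divide_distrib algebra_simps)
    also have "\<dots> = c $ x / M * cobd ?G c
        - (if x \<in> odd_coords c then fsgn x (odd_coords c) / M * (?G (c - axis x 1) + ?G (c + axis x 1)) else 0)"
      by (simp add: sum_subtractf cobd_def sum_distrib_left)
    finally show ?thesis by (simp add: cobd_cup)
  qed
  have "cup \<Psi> (x # xs) c = (if x \<in> odd_coords c then fsgn x (odd_coords c) / M * (?G (c - axis x 1) + ?G (c + axis x 1)) else 0)
      - cobd (\<lambda>c. \<theta> c * ?G c) c" for c
  proof -
    have "cobd (\<lambda>c. \<Psi> c $ x * ?G c) c = cobd (\<lambda>c. c $ x / M * ?G c) c + cobd (\<lambda>c. \<theta> c * ?G c) c"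
      unfolding cobd_def sum.distrib[symmetric] by (intro sum.cong refl) (simp add: \<theta>_def algebra_simps)
    then show ?thesis unfolding cup_Cons lin by simp
  qed
  then have "cup_integral M \<Psi> (x # xs) D = (\<Sum>c\<in>period_box M. (if x \<in> D then fsgn x D / M *
        ((if odd_coords c = D then ?G (c - axis x 1) else 0) + (if odd_coords c = D then ?G (c + axis x 1) else 0)) else 0)
      - (if odd_coords c = D then cobd (\<lambda>c. \<theta> c * ?G c) c else 0))"
    unfolding cup_integral_def by (intro sum.cong refl) (auto simp del: cup.simps)
  also have "\<dots> = (\<Sum>c\<in>period_box M. if x \<in> D then fsgn x D / M *
        ((if odd_coords c = D then ?G (c - axis x 1) else 0) + (if odd_coords c = D then ?G (c + axis x 1) else 0)) else 0)"
    unfolding sum_subtractf sum_cobd_periodic[OF M \<theta>G] by simp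
  also have "\<dots> = 2 / M * create x (cup_integral M \<Psi> xs) D"
  proof (cases "x \<in> D")
    case True
    then have "(\<Sum>c\<in>period_box M. if x \<in> D then fsgn x D / M *
          ((if odd_coords c = D then ?G (c - axis x 1) else 0) + (if odd_coords c = D then ?G (c + axis x 1) else 0)) else 0)
        = fsgn x D / M * ((\<Sum>c\<in>period_box M. if odd_coords c = D then ?G (c - axis x 1) else 0)
          + (\<Sum>c\<in>period_box M. if odd_coords c = D then ?G (c + axis x 1) else 0))"
      by (simp only: if_True sum_distrib_left[symmetric] sum.distrib)
    also have "\<dots> = 2 / M * create x (cup_integral M \<Psi> xs) D"
      unfolding sum_type_shift[OF M G True] using True by (simp add: create_def cup_integral_def)
    finally show ?thesis .
  qed (simp add: create_def)
  finally show ?thesis .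
qed

lemma cup_integral_eq_wedge:
  assumes M: "0 < M" "even M" and \<Psi>: "equivariant M \<Psi>"
  shows "cup_integral M \<Psi> xs D = (2 / M) ^ length xs * cup_integral M \<Psi> [] {} * wedge xs D"
proof (induction xs arbitrary: D)
  case Nil
  show ?case
  proof (cases "D = {}")
    case False
    then have "cup_integral M \<Psi> [] D = 0"
      unfolding cup_integral_def by (intro sum.neutral ballI) simp
    then show ?thesis using False by simp
  qed simp
next
  case (Cons x xs)
  then show ?case unfolding cup_integral_Cons[OF assms] by (simp add: create_def)
qed

lemma cup_integral_det_tensor:
  fixes L :: "'n::finite list"
  assumes M: "0 < M" "even M" and \<Psi>: "equivariant M \<Psi>" and L: "distinct L" "set L = UNIV"
  shows "\<exists>k. \<forall>J. det_tensor J = k * cup_integral M \<Psi> (map J L) UNIV"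
proof -
  define C where "C = (2 / M) ^ length L * cup_integral M \<Psi> [] {} * wedge L UNIV"
  have "0 \<in> period_box M" using M by (simp add: period_box_def)
  \<comment> \<open>This is the number of grid vertices in one period.\<close>
  then have "0 < cup_integral M \<Psi> [] {}"
    unfolding cup_integral_def by (rule sum_pos2[OF finite_period_box]) (auto simp: odd_coords_def)
  then have "C \<noteq> 0" using M wedge_nonzero[OF L(1)] L by (simp add: C_def)
  moreover have "cup_integral M \<Psi> (map J L) UNIV = C * det_tensor J" for J
    by (simp add: cup_integral_eq_wedge[OF M \<Psi>, of "map J L"] C_def wedge_det_tensor[OF L])
  ultimately show ?thesis by (intro exI[of _ "1 / C"]) simp
qed

section \<open>Flags of faces and subspaces of tensors\<close>

definition facet :: "int ^ 'n::finite \<Rightarrow> int ^ 'n \<Rightarrow> bool" where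
  "facet c' c \<longleftrightarrow> (\<exists>i\<in>odd_coords c. c' = c - axis i 1 \<or> c' = c + axis i 1)"

definition function_subspace :: "('a \<Rightarrow> real) set \<Rightarrow> bool" where
  "function_subspace V \<longleftrightarrow> (\<lambda>x. 0) \<in> V \<and> (\<forall>f\<in>V. \<forall>g\<in>V. (\<lambda>x. f x + g x) \<in> V) \<and> (\<forall>f\<in>V. \<forall>a. (\<lambda>x. a * f x) \<in> V)"

lemma function_subspace_scale: "function_subspace V \<Longrightarrow> f \<in> V \<Longrightarrow> (\<lambda>x. a * f x) \<in> V"
  by (simp add: function_subspace_def)

lemma function_subspace_diff:
  assumes "function_subspace V" "f \<in> V" "g \<in> V"
  shows "(\<lambda>x. f x - g x) \<in> V"
proof -
  have "(\<lambda>x. f x + (- 1) * g x) \<in> V"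
    using assms function_subspace_scale[OF assms(1,3), of "- 1"] unfolding function_subspace_def by (elim conjE) (drule (1) bspec, drule (1) bspec, assumption)
  then show ?thesis by simp
qed

lemma function_subspace_sum:
  assumes V: "function_subspace V" and "finite A" "\<And>a. a \<in> A \<Longrightarrow> f a \<in> V"
  shows "(\<lambda>x. \<Sum>a\<in>A. f a x) \<in> V"
  using assms(2,3)
proof (induction A rule: finite_induct)
  case empty
  then show ?case using V by (simp add: function_subspace_def)
next
  case (insert a A)
  then show ?case using V by (simp add: function_subspace_def)
qed

text \<open>Downward induction on the length \<open>m\<close> of an initial flag: the product along
  it times the remaining cup product is a combination of the same expressions for its one-step
  extensions, and complete flags are covered by \<open>chains\<close>.\<close>

lemma cup_in_subspace:
  fixes L :: "'n::finite list"
  assumes V: "function_subspace V"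
    and chains: "\<And>\<gamma>. \<gamma> 0 = c \<Longrightarrow> (\<And>k. k < length L \<Longrightarrow> facet (\<gamma> (Suc k)) (\<gamma> k)) \<Longrightarrow>
      (\<lambda>J. \<Prod>k<length L. (\<Psi> (\<gamma> k) - \<Psi> (\<gamma> (Suc k))) $ J (L ! k)) \<in> V"
  shows "(\<lambda>J. cup \<Psi> (map J L) c) \<in> V"
proof -
  have "(\<lambda>J. (\<Prod>k<m. (\<Psi> (\<gamma> k) - \<Psi> (\<gamma> (Suc k))) $ J (L ! k)) * cup \<Psi> (map J (drop m L)) (\<gamma> m)) \<in> V"
    if "m \<le> length L" "\<gamma> 0 = c" "\<And>k. k < m \<Longrightarrow> facet (\<gamma> (Suc k)) (\<gamma> k)" for m \<gamma>
    using that
  proof (induction m arbitrary: \<gamma> rule: inc_induct)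
    case base
    then show ?case
      using function_subspace_scale[OF V chains[of \<gamma>], of "cup \<Psi> [] (\<gamma> (length L))"] by (simp add: mult.commute)
  next
    case (step m)
    define P where "P J = (\<Prod>k<m. (\<Psi> (\<gamma> k) - \<Psi> (\<gamma> (Suc k))) $ J (L ! k))" for J
    let ?D = "odd_coords (\<gamma> m)"
    have next_V: "(\<lambda>J. P J * (\<Psi> (\<gamma> m) - \<Psi> c') $ J (L ! m) * cup \<Psi> (map J (drop (Suc m) L)) c') \<in> V"
      if c': "facet c' (\<gamma> m)" for c'
    proof -
      let ?\<gamma> = "\<gamma>(Suc m := c')"
      have "(\<lambda>J. (\<Prod>k<Suc m. (\<Psi> (?\<gamma> k) - \<Psi> (?\<gamma> (Suc k))) $ J (L ! k)) * cup \<Psi> (map J (drop (Suc m) L)) (?\<gamma> (Suc m))) \<in> V"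
        by (rule step.IH) (use step.prems c' in \<open>auto simp: less_Suc_eq\<close>)
      moreover have "(\<Prod>k<m. (\<Psi> (?\<gamma> k) - \<Psi> (?\<gamma> (Suc k))) $ J (L ! k)) = P J" for J
        unfolding P_def by (rule prod.cong) auto
      ultimately show ?thesis by simp
    qed
    have "(\<lambda>J. \<Sum>i\<in>?D. fsgn i ?D * (
        P J * (\<Psi> (\<gamma> m) - \<Psi> (\<gamma> m - axis i 1)) $ J (L ! m) * cup \<Psi> (map J (drop (Suc m) L)) (\<gamma> m - axis i 1) -
        P J * (\<Psi> (\<gamma> m) - \<Psi> (\<gamma> m + axis i 1)) $ J (L ! m) * cup \<Psi> (map J (drop (Suc m) L)) (\<gamma> m + axis i 1))) \<in> V"
      by (intro function_subspace_sum[OF V] function_subspace_scale[OF V] function_subspace_diff[OF V] next_V)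
         (auto simp: facet_def)
    moreover have "drop m L = L ! m # drop (Suc m) L" using step.hyps by (simp add: Cons_nth_drop_Suc)
    then have "P J * cup \<Psi> (map J (drop m L)) (\<gamma> m) = (\<Sum>i\<in>?D. fsgn i ?D * (
        P J * (\<Psi> (\<gamma> m) - \<Psi> (\<gamma> m - axis i 1)) $ J (L ! m) * cup \<Psi> (map J (drop (Suc m) L)) (\<gamma> m - axis i 1) -
        P J * (\<Psi> (\<gamma> m) - \<Psi> (\<gamma> m + axis i 1)) $ J (L ! m) * cup \<Psi> (map J (drop (Suc m) L)) (\<gamma> m + axis i 1)))" for J
      by (simp only: list.map cup.simps sum_distrib_left) (intro sum.cong refl, simp add: algebra_simps)
    ultimately show ?case unfolding P_def[symmetric] by (simp only:)
  qed
  from this[of 0 "\<lambda>k. c"] show ?thesis by simp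
qed

section \<open>Vertices, stars and orbits of the triangulation\<close>

text \<open>Lattice vectors become coefficient vectors of polynomials, evaluated at a real number
  that is a root of none of the countably many nonzero ones. Pulling back the order of the reals
  gives the translation-invariant total order.\<close>

lemma ex_injective_additive: "\<exists>lam :: int ^ 'n::finite \<Rightarrow> real. inj lam \<and> (\<forall>x y. lam (x + y) = lam x + lam y)"
proof -
  define P where "P g = (\<Sum>i\<in>UNIV. monom (real_of_int (g $ i)) (to_nat i))" for g :: "int ^ 'n"
  have coeff: "coeff (P g) (to_nat i) = g $ i" for g i
  proof -
    have "coeff (P g) (to_nat i) = (\<Sum>j\<in>UNIV. if j = i then real_of_int (g $ j) else 0)"
      unfolding P_def coeff_sum by (intro sum.cong) auto
    then show ?thesis by simp
  qed
  have "P g \<noteq> 0" if g: "g \<noteq> 0" for g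
  proof
    assume "P g = 0"
    then have "g $ i = 0" for i using coeff[of g i] by simp
    then show False using g by (simp add: vec_eq_iff)
  qed
  then have "countable (\<Union>g\<in>- {0}. {t. poly (P g) t = 0})"
    by (intro countable_UN[OF countableI_type] countable_finite poly_roots_finite) simp
  then obtain t where t: "t \<notin> (\<Union>g\<in>- {0}. {t. poly (P g) t = 0})"
    using uncountable_UNIV_real by (metis UNIV_eq_I)
  define lam where "lam g = poly (P g) t" for g
  have lam: "lam g = (\<Sum>i\<in>UNIV. g $ i * t ^ to_nat i)" for g
    by (simp add: lam_def P_def poly_sum poly_monom)
  have add: "lam (x + y) = lam x + lam y" for x y
    by (simp add: lam algebra_simps sum.distrib)
  have "inj lam"
  proof (rule injI)
    fix x y assume "lam x = lam y"
    then have "lam (x - y) = 0" using add[of "x - y" y] by simp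
    then show "x = y" using t by (auto simp: lam_def)
  qed
  then show ?thesis using add by blast
qed

lemma lattice_vec_add: "lattice_vec (g + h) = lattice_vec g + lattice_vec h"
  by (simp add: lattice_vec_def vec_eq_iff)

locale lattice_triangulation =
  fixes K :: "'v set set" and act :: "int ^ 'n::finite \<Rightarrow> 'v \<Rightarrow> 'v" and h :: "('v \<Rightarrow> real) \<Rightarrow> real ^ 'n"
  assumes complex: "abstract_complex K" and action: "simplicial_action K act" and free: "free_action K act"
    and homeo: "homeomorphic_map (realization_topology K) euclidean h"
    and equivar: "\<And>g x. x \<in> realization K \<Longrightarrow> h (realize_map (act g) x) = h x + lattice_vec g"
begin

lemma face_in: "\<sigma> \<in> K \<Longrightarrow> \<tau> \<subseteq> \<sigma> \<Longrightarrow> \<tau> \<noteq> {} \<Longrightarrow> \<tau> \<in> K"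
  using complex unfolding abstract_complex_def by blast

lemma simplex_finite: "\<sigma> \<in> K \<Longrightarrow> finite \<sigma>" and simplex_nonempty: "\<sigma> \<in> K \<Longrightarrow> \<sigma> \<noteq> {}"
  using complex unfolding abstract_complex_def by blast+

lemma act_0: "v \<in> \<Union>K \<Longrightarrow> act 0 v = v"
  and act_add: "v \<in> \<Union>K \<Longrightarrow> act (g + k) v = act g (act k v)"
  and act_simplex: "\<sigma> \<in> K \<Longrightarrow> act g ` \<sigma> \<in> K"
  using action unfolding simplicial_action_def by blast+

lemma act_vertex: "v \<in> \<Union>K \<Longrightarrow> act g v \<in> \<Union>K"
  using act_simplex by blast

lemma act_uminus: "v \<in> \<Union>K \<Longrightarrow> act (- g) (act g v) = v"
  using act_add[of v "- g" g] act_0 by simp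

lemma inj_on_act: "inj_on (act g) (\<Union>K)"
  by (metis act_uminus inj_onI)

lemma act_image_add: "\<sigma> \<in> K \<Longrightarrow> act g ` act k ` \<sigma> = act (g + k) ` \<sigma>"
  unfolding image_image by (intro image_cong refl) (metis UnionI act_add)

lemma supp_in: "x \<in> realization K \<Longrightarrow> {v. x v \<noteq> 0} \<in> K"
  by (simp add: realization_def)

text \<open>The action is injective on vertices, so \<open>act g v\<close> receives weight from
  \<open>v\<close> alone.\<close>

lemma realize_map_act:
  assumes x: "x \<in> realization K" and v: "v \<in> \<Union>K"
  shows "realize_map (act g) x (act g v) = x v"
proof -
  have "{u. x u \<noteq> 0 \<and> act g u = act g v} = (if x v = 0 then {} else {v})"
    using supp_in[OF x] v inj_on_act[of g] by (auto dest: inj_onD)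
  then show ?thesis by (simp add: realize_map_def)
qed

lemma realize_map_outside:
  assumes "w \<notin> act g ` {v. x v \<noteq> 0}"
  shows "realize_map (act g) x w = 0"
proof -
  have "{v. x v \<noteq> 0 \<and> act g v = w} = {}" using assms by auto
  then show ?thesis by (simp only: realize_map_def sum.empty)
qed

lemma realize_map_in:
  assumes x: "x \<in> realization K"
  shows "realize_map (act g) x \<in> realization K"
proof -
  let ?S = "{v. x v \<noteq> 0}"
  have S: "?S \<in> K" "?S \<subseteq> \<Union>K" using supp_in[OF x] by auto
  have supp: "{w. realize_map (act g) x w \<noteq> 0} = act g ` ?S"
  proof (intro equalityI subsetI)
    show "w \<in> act g ` ?S" if "w \<in> {w. realize_map (act g) x w \<noteq> 0}" for w
      using realize_map_outside that by blast
    show "w \<in> {w. realize_map (act g) x w \<noteq> 0}" if "w \<in> act g ` ?S" for w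
    proof -
      from that obtain v where v: "v \<in> ?S" "w = act g v" by blast
      have "v \<in> \<Union>K" using v(1) S(2) by (rule subsetD[rotated])
      then have "realize_map (act g) x w = x v" using realize_map_act[OF x, of v g] v(2) by simp
      then show ?thesis using v by simp
    qed
  qed
  have "(\<Sum>w\<in>act g ` ?S. realize_map (act g) x w) = (\<Sum>v\<in>?S. realize_map (act g) x (act g v))"
    by (rule sum.reindex_cong[OF inj_on_subset[OF inj_on_act S(2)] refl refl])
  also have "\<dots> = (\<Sum>v\<in>?S. x v)"
    by (rule sum.cong[OF refl realize_map_act[OF x subsetD[OF S(2)]]])
  also have "\<dots> = 1" using x by (simp add: realization_def)
  finally have "(\<Sum>w\<in>act g ` ?S. realize_map (act g) x w) = 1" .
  moreover have "0 \<le> realize_map (act g) x w" for w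
    unfolding realize_map_def using x by (intro sum_nonneg) (simp add: realization_def)
  ultimately show ?thesis
    using act_simplex[OF S(1)] unfolding realization_def supp by (simp add: supp)
qed

section \<open>Barycentres and freeness on vertices\<close>

definition bary :: "'v set \<Rightarrow> 'v \<Rightarrow> real" where
  "bary \<sigma> v = (if v \<in> \<sigma> then 1 / card \<sigma> else 0)"

lemma supp_bary: "\<sigma> \<in> K \<Longrightarrow> {v. bary \<sigma> v \<noteq> 0} = \<sigma>"
  using simplex_finite simplex_nonempty by (auto simp: bary_def)

lemma bary_in: "\<sigma> \<in> K \<Longrightarrow> bary \<sigma> \<in> realization K"
  unfolding realization_def mem_Collect_eq supp_bary
  using simplex_finite simplex_nonempty by (auto simp: bary_def)

lemma card_act: "\<sigma> \<in> K \<Longrightarrow> card (act g ` \<sigma>) = card \<sigma>"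
  by (metis Union_upper card_image inj_on_act inj_on_subset)

lemma realize_bary: "\<sigma> \<in> K \<Longrightarrow> realize_map (act g) (bary \<sigma>) = bary (act g ` \<sigma>)"
proof
  fix w assume \<sigma>: "\<sigma> \<in> K"
  show "realize_map (act g) (bary \<sigma>) w = bary (act g ` \<sigma>) w"
  proof (cases "w \<in> act g ` \<sigma>")
    case True
    then obtain v where v: "v \<in> \<sigma>" "w = act g v" by blast
    then show ?thesis using realize_map_act[OF bary_in[OF \<sigma>], of v g] \<sigma> card_act[OF \<sigma>]
      by (auto simp: bary_def)
  next
    case False
    then show ?thesis using realize_map_outside[of w g "bary \<sigma>"] supp_bary[OF \<sigma>] by (simp add: bary_def)
  qed
qed

text \<open>Freeness speaks of points of the realization; it is applied to the barycentre of the
  singleton simplex of \<open>v\<close>.\<close>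

lemma act_fixed_vertex:
  assumes v: "v \<in> \<Union>K" and fixed: "act g v = v"
  shows "g = 0"
proof -
  have s: "{v} \<in> K" using v face_in by blast
  have "realize_map (act g) (bary {v}) = bary {v}"
    using realize_bary[OF s] fixed by simp
  then show ?thesis using free bary_in[OF s] by (auto simp: free_action_def)
qed

lemma act_eq_iff: "v \<in> \<Union>K \<Longrightarrow> act g v = act k v \<longleftrightarrow> g = k"
proof
  assume v: "v \<in> \<Union>K" and "act g v = act k v"
  then have "act (- k + g) v = v" by (metis act_add act_uminus)
  then have "- k + g = 0" using act_fixed_vertex v by blast
  then show "g = k" by (simp add: eq_neg_iff_add_eq_0)
qed simp

section \<open>Orbit representatives and lattice coordinates of vertices\<close>

definition base :: "'v \<Rightarrow> 'v" where
  "base v = (SOME u. u \<in> range (\<lambda>g. act g v))"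

definition coord :: "'v \<Rightarrow> int ^ 'n" where
  "coord v = (THE g. act g (base v) = v)"

lemma orbit_act: "v \<in> \<Union>K \<Longrightarrow> range (\<lambda>g. act g (act k v)) = range (\<lambda>g. act g v)"
proof (intro equalityI subsetI)
  fix w assume v: "v \<in> \<Union>K"
  show "w \<in> range (\<lambda>g. act g v)" if "w \<in> range (\<lambda>g. act g (act k v))"
  proof -
    from that obtain g where "w = act g (act k v)" by blast
    then have "w = act (g + k) v" using act_add[OF v, of g k] by simp
    then show ?thesis by blast
  qed
  show "w \<in> range (\<lambda>g. act g (act k v))" if "w \<in> range (\<lambda>g. act g v)"
  proof -
    from that obtain g where "w = act g v" by blast
    then have "w = act (g - k) (act k v)" using act_add[OF v, of "g - k" k] by simp
    then show ?thesis by blast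
  qed
qed

text \<open>The choice in \<open>base\<close> sees only the orbit as a set, and the action does not
  change that set.\<close>

lemma base_act: "v \<in> \<Union>K \<Longrightarrow> base (act k v) = base v"
  unfolding base_def orbit_act ..

lemma base_vertex: "v \<in> \<Union>K \<Longrightarrow> base v \<in> \<Union>K"
proof -
  assume v: "v \<in> \<Union>K"
  have "base v \<in> range (\<lambda>g. act g v)" unfolding base_def by (rule someI) (rule rangeI)
  then show ?thesis using act_vertex[OF v] by (metis rangeE)
qed

lemma coord_eqI: "v \<in> \<Union>K \<Longrightarrow> act g (base v) = v \<Longrightarrow> coord v = g"
  unfolding coord_def by (rule the_equality) (use act_eq_iff base_vertex in metis)+

lemma act_coord: assumes v: "v \<in> \<Union>K" shows "act (coord v) (base v) = v"
proof -
  have "base v \<in> range (\<lambda>g. act g v)" unfolding base_def by (rule someI) (rule rangeI)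
  then obtain k where "base v = act k v" by blast
  then have "act (- k) (base v) = v" using act_uminus[OF v] by simp
  then show ?thesis using coord_eqI[OF v] by simp
qed

lemma coord_act: assumes v: "v \<in> \<Union>K" shows "coord (act g v) = coord v + g"
proof (rule coord_eqI)
  show "act g v \<in> \<Union>K" by (rule act_vertex[OF v])
  have "act (g + coord v) (base v) = act g v" using act_add[OF base_vertex[OF v]] act_coord[OF v] by simp
  then show "act (coord v + g) (base (act g v)) = act g v" by (simp add: base_act[OF v] add.commute)
qed

section \<open>Open stars\<close>

definition star :: "'v \<Rightarrow> ('v \<Rightarrow> real) set" where
  "star v = {x \<in> realization K. x v \<noteq> 0}"

lemma openin_star: "openin (realization_topology K) (star v)"
proof -
  have "open {x :: 'v \<Rightarrow> real. x v \<noteq> 0}"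
    by (intro open_Collect_neq continuous_on_product_coordinates continuous_on_const)
  moreover have "star v \<inter> closed_cell K \<sigma> = closed_cell K \<sigma> \<inter> {x. x v \<noteq> 0}" for \<sigma>
    by (auto simp: star_def closed_cell_def)
  ultimately show ?thesis
    unfolding openin_realization_topology by (auto simp: star_def openin_open)
qed

lemma h_surj: "h ` realization K = UNIV"
  using homeomorphic_imp_surjective_map[OF homeo] by simp

lemma h_inj: "inj_on h (realization K)"
  using homeomorphic_imp_injective_map[OF homeo] by simp

lemma open_h_image: "openin (realization_topology K) U \<Longrightarrow> open (h ` U)"
  using homeomorphic_imp_open_map[OF homeo] by (simp add: open_map_def)

lemma star_act: "v \<in> \<Union>K \<Longrightarrow> y \<in> h ` star v \<Longrightarrow> y + lattice_vec g \<in> h ` star (act g v)"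
proof -
  assume v: "v \<in> \<Union>K" and "y \<in> h ` star v"
  then obtain x where x: "x \<in> realization K" "x v \<noteq> 0" "y = h x" by (auto simp: star_def)
  then have "realize_map (act g) x \<in> star (act g v)"
    using realize_map_in realize_map_act v by (simp add: star_def)
  then show ?thesis using equivar[OF x(1), of g] x(3) by (metis imageI)
qed

text \<open>A Lebesgue number for the cover of the compact unit cube by the images of the open
  stars.\<close>

lemma ex_star_radius: "\<exists>e>0. \<forall>y\<in>cbox 0 1. \<exists>v\<in>\<Union>K. ball y e \<subseteq> h ` star v"
proof -
  have "cbox 0 1 \<subseteq> \<Union> ((\<lambda>v. h ` star v) ` \<Union>K)"
  proof
    fix y :: "real ^ 'n"
    obtain x where x: "x \<in> realization K" "y = h x" using h_surj by blast
    obtain v where "x v \<noteq> 0" using simplex_nonempty[OF supp_in[OF x(1)]] by blast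
    moreover then have "v \<in> \<Union>K" using supp_in[OF x(1)] by blast
    ultimately show "y \<in> \<Union> ((\<lambda>v. h ` star v) ` \<Union>K)" using x by (auto simp: star_def)
  qed
  then obtain e where "0 < e" "\<And>y. y \<in> cbox 0 1 \<Longrightarrow> \<exists>G\<in>(\<lambda>v. h ` star v) ` \<Union>K. ball y e \<subseteq> G"
    using Heine_Borel_lemma[of "cbox 0 (1 :: real ^ 'n)" "(\<lambda>v. h ` star v) ` \<Union>K"]
      open_h_image[OF openin_star] compact_cbox by (metis (no_types, lifting) imageE)
  then show ?thesis by blast
qed

section \<open>Finiteness of the set of orbits\<close>

lemma openin_Diff_bary:
  assumes "S \<subseteq> bary ` K"
  shows "openin (realization_topology K) (realization K - S)"
  unfolding openin_realization_topology
proof (intro conjI ballI)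
  fix \<sigma> assume \<sigma>: "\<sigma> \<in> K"
  \<comment> \<open>A barycentre determines its simplex, so a closed cell contains only the
    barycentres of its own faces, which are finitely many.\<close>
  have "S \<inter> closed_cell K \<sigma> \<subseteq> bary ` Pow \<sigma>"
  proof
    fix x assume x: "x \<in> S \<inter> closed_cell K \<sigma>"
    then obtain \<tau> where \<tau>: "\<tau> \<in> K" "x = bary \<tau>" using assms by blast
    then have "\<tau> \<subseteq> \<sigma>" using x supp_bary[OF \<tau>(1)] by (simp add: closed_cell_def)
    then show "x \<in> bary ` Pow \<sigma>" using \<tau> by blast
  qed
  then have fin: "finite (S \<inter> closed_cell K \<sigma>)"
    by (rule finite_subset) (use simplex_finite[OF \<sigma>] in simp)
  have "open (- {y})" for y :: "'v \<Rightarrow> real"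
  proof -
    have "- {y} = (\<Union>v. {x. x v \<noteq> y v})" by (auto simp: fun_eq_iff)
    moreover have "open {x. x v \<noteq> y v}" for v
      by (intro open_Collect_neq continuous_on_product_coordinates continuous_on_const)
    ultimately show ?thesis by (simp only: open_UN ball_UNIV simp_thms)
  qed
  then have "open (\<Inter>y\<in>S \<inter> closed_cell K \<sigma>. - {y})" using fin by (intro open_INT) auto
  moreover have "(realization K - S) \<inter> closed_cell K \<sigma> = closed_cell K \<sigma> \<inter> (\<Inter>y\<in>S \<inter> closed_cell K \<sigma>. - {y})"
    by (auto simp: closed_cell_def)
  ultimately show "openin (top_of_set (closed_cell K \<sigma>)) ((realization K - S) \<inter> closed_cell K \<sigma>)"
    by (auto simp: openin_open)
qed blast

lemma closed_h_bary:
  assumes "S \<subseteq> bary ` K"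
  shows "closed (h ` S)"
proof -
  have "S \<subseteq> realization K" using assms bary_in by blast
  then have "h ` (realization K - S) = - h ` S"
    using h_surj h_inj by (metis Compl_eq_Diff_UNIV inj_on_image_set_diff Diff_subset order_refl)
  then show ?thesis using open_h_image[OF openin_Diff_bary[OF assms]] by (simp add: closed_def)
qed

text \<open>Every set of barycentres is closed, so only finitely many of them lie in the compact unit cube.\<close>

lemma finite_simplex_orbits: "finite (simplex_orbits K act d)"
proof -
  define B where "B = {x \<in> bary ` K. h x \<in> cbox 0 1}"
  have "finite (h ` B)"
  proof (rule ccontr)
    assume "infinite (h ` B)"
    moreover have "h ` B \<subseteq> cbox 0 1" by (auto simp: B_def)
    ultimately obtain l where l: "l islimpt (h ` B)"
      using compact_cbox compact_eq_Bolzano_Weierstrass by blast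
    \<comment> \<open>Without \<open>l\<close> itself the set still accumulates at \<open>l\<close>,
      yet its image is closed and would have to contain \<open>l\<close>.\<close>
    let ?S = "{x \<in> B. h x \<noteq> l}"
    have "h ` ?S = h ` B - {l}" by auto
    then have "l islimpt (h ` ?S)" using l by (metis islimpt_punctured)
    moreover have "closed (h ` ?S)" by (rule closed_h_bary) (auto simp: B_def)
    ultimately have "l \<in> h ` ?S" using closed_limpt by blast
    then show False by blast
  qed
  moreover have "inj_on h B" using bary_in by (intro inj_on_subset[OF h_inj]) (auto simp: B_def)
  ultimately have finB: "finite B" by (rule finite_imageD)
  have "simplex_orbits K act d \<subseteq> (\<lambda>x. range (\<lambda>g. act g ` {v. x v \<noteq> 0})) ` B"
  proof
    fix O' assume "O' \<in> simplex_orbits K act d"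
    then obtain \<sigma> where \<sigma>: "\<sigma> \<in> K" "O' = range (\<lambda>g. act g ` \<sigma>)"
      by (auto simp: simplex_orbits_def simplices_of_dim_def)
    \<comment> \<open>Subtracting the integer parts moves the barycentre into the unit cube without
      leaving the orbit.\<close>
    define g :: "int ^ 'n" where "g = (\<chi> i. - \<lfloor>h (bary \<sigma>) $ i\<rfloor>)"
    have g\<sigma>: "act g ` \<sigma> \<in> K" by (rule act_simplex[OF \<sigma>(1)])
    have "h (bary (act g ` \<sigma>)) = h (bary \<sigma>) + lattice_vec g"
      using equivar[OF bary_in[OF \<sigma>(1)], of g] realize_bary[OF \<sigma>(1)] by simp
    also have "\<dots> \<in> cbox 0 1"
    proof -
      have "0 \<le> h (bary \<sigma>) $ i + lattice_vec g $ i" "h (bary \<sigma>) $ i + lattice_vec g $ i \<le> 1" for i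
        unfolding g_def lattice_vec_def by simp_all linarith+
      then show ?thesis by (simp add: mem_box_cart)
    qed
    finally have "bary (act g ` \<sigma>) \<in> B" using g\<sigma> by (auto simp: B_def)
    moreover have "range (\<lambda>k. act k ` act g ` \<sigma>) = O'"
    proof -
      have "range (\<lambda>k. act k ` act g ` \<sigma>) = (\<lambda>k. act k ` \<sigma>) ` range (\<lambda>k. k + g)"
        unfolding image_image[of "\<lambda>k. act k ` \<sigma>"] act_image_add[OF \<sigma>(1)] ..
      also have "range (\<lambda>k. k + g) = UNIV" by (metis surj_def diff_add_cancel)
      finally show ?thesis using \<sigma>(2) by simp
    qed
    ultimately show "O' \<in> (\<lambda>x. range (\<lambda>g. act g ` {v. x v \<noteq> 0})) ` B"
      by (intro image_eqI[where x = "bary (act g ` \<sigma>)"]) (simp_all only: supp_bary[OF g\<sigma>])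
  qed
  then show ?thesis using finB finite_subset by blast
qed

end

section \<open>Simplicial approximation\<close>

lemma sorted_list_of_set_translate:
  fixes A :: "real set"
  assumes "finite A"
  shows "sorted_list_of_set ((\<lambda>x. x + a) ` A) = map (\<lambda>x. x + a) (sorted_list_of_set A)"
proof -
  have "sorted_wrt (<) (map (\<lambda>x. x + a) (sorted_list_of_set A))"
    by (simp add: sorted_wrt_map)
  moreover have "length (map (\<lambda>x. x + a) (sorted_list_of_set A)) = card ((\<lambda>x. x + a) ` A)"
    by (simp add: card_image)
  moreover have "set (map (\<lambda>x. x + a) (sorted_list_of_set A)) = (\<lambda>x. x + a) ` A"
    using assms by simp
  ultimately show ?thesis
    using sorted_list_of_set_unique[of "(\<lambda>x. x + a) ` A"] assms by blast
qed

definition grid_point :: "int \<Rightarrow> int ^ 'n \<Rightarrow> real ^ 'n" where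
  "grid_point M w = (\<chi> i. w $ i / M)"

text \<open>The grid vertices of the face with centre \<open>c\<close>: an even coordinate of
  \<open>c\<close> forces equality, an odd one leaves two choices.\<close>

definition corners :: "int ^ 'n::finite \<Rightarrow> (int ^ 'n) set" where
  "corners c = {w. odd_coords w = {} \<and> (\<forall>i. \<bar>w $ i - c $ i\<bar> \<le> 1)}"

lemma finite_corners: "finite (corners c)"
proof (rule finite_subset)
  show "corners c \<subseteq> (\<lambda>b. b + (\<chi> i. c $ i - 1)) ` period_box 3"
  proof
    fix w assume "w \<in> corners c"
    then have w: "\<bar>w $ i - c $ i\<bar> \<le> 1" for i by (simp add: corners_def)
    have "0 \<le> w $ i - (c $ i - 1) \<and> w $ i - (c $ i - 1) < 3" for i using w[of i] by linarith
    then show "w \<in> (\<lambda>b. b + (\<chi> i. c $ i - 1)) ` period_box 3"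
      by (intro image_eqI[of _ _ "w - (\<chi> i. c $ i - 1)"]) (auto simp: period_box_def)
  qed
qed (simp add: finite_period_box)

lemma corners_nonempty: "corners c \<noteq> {}"
proof -
  have "(\<chi> i. if odd (c $ i) then c $ i - 1 else c $ i) \<in> corners c"
    by (auto simp: corners_def odd_coords_def)
  then show ?thesis by blast
qed

lemma corners_facet:
  assumes "facet c' c"
  shows "corners c' \<subseteq> corners c"
proof
  fix w assume w: "w \<in> corners c'"
  obtain i where i: "i \<in> odd_coords c" "c' = c - axis i 1 \<or> c' = c + axis i 1"
    using assms by (auto simp: facet_def)
  have "\<bar>w $ j - c $ j\<bar> \<le> 1" for j
  proof (cases "j = i")
    case True
    have "even (w $ i)" using w by (auto simp: corners_def odd_coords_def)
    moreover have "odd (c $ i)" using i by (simp add: odd_coords_def)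
    moreover have "\<bar>w $ i - c' $ i\<bar> \<le> 1" using w by (simp add: corners_def)
    moreover have "c' $ i = c $ i - 1 \<or> c' $ i = c $ i + 1" using i(2) by (auto simp: axis_def)
    ultimately show ?thesis unfolding True by presburger
  next
    case False
    then have "c' $ j = c $ j" using i(2) by (auto simp: axis_def)
    then show ?thesis using w unfolding corners_def by (metis (mono_tags, lifting) mem_Collect_eq)
  qed
  then show "w \<in> corners c" using w by (simp add: corners_def)
qed

lemma corners_translate:
  assumes "even M"
  shows "corners (c + scale_vec M g) = (\<lambda>w. w + scale_vec M g) ` corners c"
proof (intro equalityI subsetI)
  fix w assume w: "w \<in> corners (c + scale_vec M g)"
  have "odd_coords (w + scale_vec M (- g)) = odd_coords w" by (rule odd_coords_periodic[OF assms])
  moreover have "w + scale_vec M (- g) = w - scale_vec M g" by (simp add: scale_vec_def vec_eq_iff)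
  ultimately have "w - scale_vec M g \<in> corners c"
    using w by (simp add: corners_def algebra_simps)
  then show "w \<in> (\<lambda>w. w + scale_vec M g) ` corners c" by (intro image_eqI[of _ _ "w - scale_vec M g"]) auto
qed (auto simp: corners_def odd_coords_periodic[OF assms])

text \<open>\<open>s\<close> is the vertex map of an equivariant simplicial approximation. The
  tolerance 2 in \<open>s_star\<close> is the largest coordinate difference between two corners of
  one face.\<close>

locale grid_approximation = lattice_triangulation K act h
  for K :: "'v set set" and act :: "int ^ 'n::finite \<Rightarrow> 'v \<Rightarrow> 'v" and h :: "('v \<Rightarrow> real) \<Rightarrow> real ^ 'n" +
  fixes lam :: "int ^ 'n \<Rightarrow> real" and M :: int and s :: "int ^ 'n \<Rightarrow> 'v"
  assumes lam_inj: "inj lam" and lam_add: "lam (x + y) = lam x + lam y"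
    and M: "0 < M" "even M"
    and s_vertex: "s w \<in> \<Union>K"
    and s_act: "s (w + scale_vec M g) = act g (s w)"
    and s_star: "(\<And>i. \<bar>w $ i - w' $ i\<bar> \<le> 2) \<Longrightarrow> grid_point M w \<in> h ` star (s w')"
begin

text \<open>The grid point of any one corner lies in the open stars of the images of all corners, so
  these images belong to the simplex carrying that point.\<close>

lemma corners_simplex: "s ` corners c \<in> K"
proof -
  obtain w0 where w0: "w0 \<in> corners c" using corners_nonempty by blast
  obtain x where x: "x \<in> realization K" "grid_point M w0 = h x" using h_surj by blast
  have "x (s w) \<noteq> 0" if w: "w \<in> corners c" for w
  proof -
    have "\<bar>w0 $ i - w $ i\<bar> \<le> 2" for i
    proof -
      have "\<bar>w0 $ i - c $ i\<bar> \<le> 1" "\<bar>w $ i - c $ i\<bar> \<le> 1" using w w0 by (auto simp: corners_def)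
      then show ?thesis by linarith
    qed
    then have "h x \<in> h ` star (s w)" using s_star x(2) by metis
    then obtain z where "h x = h z" "z \<in> realization K" "z (s w) \<noteq> 0" by (auto simp: star_def)
    then show ?thesis using inj_onD[OF h_inj] x(1) by metis
  qed
  then have "s ` corners c \<subseteq> {v. x v \<noteq> 0}" by blast
  then show ?thesis using face_in[OF supp_in[OF x(1)]] corners_nonempty by blast
qed

section \<open>Minimal coordinates and the tensor of a simplex\<close>

definition min_coord :: "int ^ 'n \<Rightarrow> int ^ 'n" where
  "min_coord c = arg_min_on lam (coord ` s ` corners c)"

lemma min_coord_in: "min_coord c \<in> coord ` s ` corners c"
  unfolding min_coord_def using arg_min_if_finite(1)[of "coord ` s ` corners c" lam] finite_corners corners_nonempty by blast

lemma min_coord_le: "g \<in> coord ` s ` corners c \<Longrightarrow> lam (min_coord c) \<le> lam g"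
  unfolding min_coord_def using arg_min_if_finite(2)[of "coord ` s ` corners c" lam] finite_corners corners_nonempty
  by (meson finite_imageI image_is_empty not_le)

lemma min_coord_eqI: "g \<in> coord ` s ` corners c \<Longrightarrow> (\<And>k. k \<in> coord ` s ` corners c \<Longrightarrow> lam g \<le> lam k) \<Longrightarrow> min_coord c = g"
  by (metis antisym injD lam_inj min_coord_in min_coord_le)

lemma coord_corners_translate:
  "coord ` s ` corners (c + scale_vec M g) = (\<lambda>k. k + g) ` coord ` s ` corners c"
  unfolding corners_translate[OF M(2)] image_image s_act coord_act[OF s_vertex] ..

lemma min_coord_translate: "min_coord (c + scale_vec M g) = min_coord c + g"
proof (rule min_coord_eqI)
  show "min_coord c + g \<in> coord ` s ` corners (c + scale_vec M g)"
    unfolding coord_corners_translate by (rule imageI[OF min_coord_in])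
  fix k assume "k \<in> coord ` s ` corners (c + scale_vec M g)"
  then obtain k' where "k' \<in> coord ` s ` corners c" "k = k' + g"
    unfolding coord_corners_translate by (rule imageE)
  then show "lam (min_coord c + g) \<le> lam k" using min_coord_le by (simp add: lam_add)
qed

definition Psi :: "int ^ 'n \<Rightarrow> real ^ 'n" where
  "Psi c = lattice_vec (min_coord c)"

lemma equivariant_Psi: "equivariant M Psi"
  by (simp add: equivariant_def Psi_def min_coord_translate lattice_vec_add)

definition sorted_values :: "'v set \<Rightarrow> real list" where
  "sorted_values \<sigma> = sorted_list_of_set (lam ` coord ` \<sigma>)"

text \<open>Consecutive vertex coordinates in the \<open>lam\<close>-order, smaller minus larger, to
  match the differences from a face to its facet in \<open>cup\<close>.\<close>

definition edge :: "'v set \<Rightarrow> nat \<Rightarrow> real ^ 'n" where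
  "edge \<sigma> k = lattice_vec (inv lam (sorted_values \<sigma> ! k)) - lattice_vec (inv lam (sorted_values \<sigma> ! Suc k))"

definition simplex_tensor :: "'n list \<Rightarrow> 'v set \<Rightarrow> ('n \<Rightarrow> 'n) \<Rightarrow> real" where
  "simplex_tensor L \<sigma> J = (\<Prod>k<length L. edge \<sigma> k $ J (L ! k))"

lemma lam_coord_act: "\<sigma> \<in> K \<Longrightarrow> lam ` coord ` act g ` \<sigma> = (\<lambda>x. x + lam g) ` lam ` coord ` \<sigma>"
  unfolding image_image by (intro image_cong refl) (metis UnionI coord_act lam_add)

text \<open>Translation adds \<open>lam g\<close> to all values and keeps their order, so the
  differences do not change. The bound on \<open>k\<close> keeps both positions inside the list of
  distinct values.\<close>

lemma edge_act:
  assumes \<sigma>: "\<sigma> \<in> K" and k: "Suc k < card (lam ` coord ` \<sigma>)"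
  shows "edge (act g ` \<sigma>) k = edge \<sigma> k"
proof -
  have fin: "finite (lam ` coord ` \<sigma>)" using simplex_finite[OF \<sigma>] by blast
  have len: "length (sorted_values \<sigma>) = card (lam ` coord ` \<sigma>)" by (simp add: sorted_values_def)
  have vals: "sorted_values (act g ` \<sigma>) = map (\<lambda>x. x + lam g) (sorted_values \<sigma>)"
    unfolding sorted_values_def lam_coord_act[OF \<sigma>] by (rule sorted_list_of_set_translate[OF fin])
  have "inv lam (sorted_values (act g ` \<sigma>) ! m) = inv lam (sorted_values \<sigma> ! m) + g" if "m < card (lam ` coord ` \<sigma>)" for m
  proof -
    have "sorted_values \<sigma> ! m \<in> set (sorted_values \<sigma>)" using that len by simp
    then obtain x where "sorted_values \<sigma> ! m = lam x" using fin by (auto simp: sorted_values_def)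
    moreover have "inv lam (lam x + lam g) = x + g" using lam_inj lam_add[of x g] by (metis inv_f_f)
    ultimately show ?thesis using that len lam_inj by (simp add: vals)
  qed
  then show ?thesis using k by (simp add: edge_def lattice_vec_add)
qed

lemma simplex_tensor_pure:
  assumes L: "distinct L" "set L = UNIV"
  shows "\<exists>v. \<forall>J. simplex_tensor L \<sigma> J = pure_tensor v J"
proof -
  have bij: "bij_betw ((!) L) {..<length L} UNIV"
    using bij_betw_nth[OF L(1) refl] L(2) by simp
  define v where "v j = edge \<sigma> (inv_into {..<length L} ((!) L) j)" for j
  have "simplex_tensor L \<sigma> J = pure_tensor v J" for J
  proof -
    have "pure_tensor v J = (\<Prod>k<length L. v (L ! k) $ J (L ! k))"
      unfolding pure_tensor_def by (rule prod.reindex_bij_betw[OF bij, symmetric])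
    also have "\<dots> = simplex_tensor L \<sigma> J"
      unfolding simplex_tensor_def v_def
      by (intro prod.cong refl) (use bij in \<open>simp add: bij_betw_def\<close>)
    finally show ?thesis ..
  qed
  then show ?thesis by blast
qed

text \<open>A chain of faces contributes zero unless the minimal coordinates along it strictly increase;
  then it sees \<open>n + 1\<close> distinct vertices of a single simplex, already in sorted order.\<close>

lemma chain_tensor:
  fixes \<gamma> :: "nat \<Rightarrow> int ^ 'n"
  assumes fac: "\<And>k. k < n \<Longrightarrow> facet (\<gamma> (Suc k)) (\<gamma> k)"
    and ne: "\<And>k. k < n \<Longrightarrow> Psi (\<gamma> k) \<noteq> Psi (\<gamma> (Suc k))"
  obtains \<sigma> where "\<sigma> \<in> simplices_of_dim K n" "card (lam ` coord ` \<sigma>) = Suc n"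
    "\<And>k. k < n \<Longrightarrow> edge \<sigma> k = Psi (\<gamma> k) - Psi (\<gamma> (Suc k))"
proof -
  have sub: "corners (\<gamma> k) \<subseteq> corners (\<gamma> 0)" if "k \<le> n" for k
    using that
  proof (induction k)
    case (Suc k)
    then have "corners (\<gamma> (Suc k)) \<subseteq> corners (\<gamma> k)" by (intro corners_facet fac) simp
    then show ?case using Suc by simp
  qed simp
  \<comment> \<open>The corners of a facet are among those of the face, so the minimum cannot
    decrease; as \<open>lam\<close> is injective, a change of \<open>Psi\<close> makes it increase
    strictly.\<close>
  have step: "lam (min_coord (\<gamma> k)) < lam (min_coord (\<gamma> (Suc k)))" if k: "k < n" for k
  proof -
    have "min_coord (\<gamma> (Suc k)) \<in> coord ` s ` corners (\<gamma> k)"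
      using min_coord_in[of "\<gamma> (Suc k)"] corners_facet[OF fac[OF k]] by blast
    then have "lam (min_coord (\<gamma> k)) \<le> lam (min_coord (\<gamma> (Suc k)))" by (rule min_coord_le)
    moreover have "lam (min_coord (\<gamma> k)) \<noteq> lam (min_coord (\<gamma> (Suc k)))"
      using ne[OF k] lam_inj by (auto simp: Psi_def dest: injD)
    ultimately show ?thesis by simp
  qed
  define f where "f k = lam (min_coord (\<gamma> k))" for k
  have f_less: "f i < f j" if "i < j" "j \<le> n" for i j
    using that
  proof (induction j)
    case (Suc j)
    then show ?case using step[of j] by (cases "i = j") (auto simp: f_def)
  qed simp
  \<comment> \<open>Vertices realizing the minima; those up to \<open>n\<close> are images of
    corners of the largest face, so they span a simplex.\<close>
  have "\<forall>k. \<exists>v. v \<in> s ` corners (\<gamma> k) \<and> coord v = min_coord (\<gamma> k)" using min_coord_in by (metis imageE)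
  then obtain u where u: "\<And>k. u k \<in> s ` corners (\<gamma> k)" "\<And>k. coord (u k) = min_coord (\<gamma> k)" by metis
  define \<sigma> where "\<sigma> = u ` {..n}"
  have vals: "lam ` coord ` \<sigma> = f ` {..n}" by (simp add: \<sigma>_def image_image u f_def)
  have injf: "inj_on f {..n}"
    by (rule linorder_inj_onI') (use f_less in force)
  have "card \<sigma> = Suc n"
    unfolding \<sigma>_def using injf by (subst card_image) (auto simp: inj_on_def f_def u(2)[symmetric])
  moreover have "\<sigma> \<in> K"
  proof (rule face_in[OF corners_simplex])
    show "\<sigma> \<subseteq> s ` corners (\<gamma> 0)" using u(1) sub by (fastforce simp: \<sigma>_def)
  qed (auto simp: \<sigma>_def)
  moreover have card_vals: "card (lam ` coord ` \<sigma>) = Suc n" unfolding vals using injf by (simp add: card_image)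
  moreover have "sorted_values \<sigma> = map f [0..<Suc n]"
  proof -
    have "sorted_wrt (<) (map f [0..<Suc n])"
      unfolding sorted_wrt_map sorted_wrt_iff_nth_less by (auto simp: f_less less_Suc_eq_le simp del: upt_Suc)
    moreover have "set (map f [0..<Suc n]) = lam ` coord ` \<sigma>"
      unfolding vals by (simp add: atLeast0LessThan lessThan_Suc_atMost del: upt_Suc)
    ultimately show ?thesis
      unfolding sorted_values_def using sorted_list_of_set_unique[of "lam ` coord ` \<sigma>" "map f [0..<Suc n]"] card_vals vals
      by (simp del: upt_Suc)
  qed
  then have "inv lam (sorted_values \<sigma> ! k) = min_coord (\<gamma> k)" if "k \<le> n" for k
    using that lam_inj by (simp add: f_def del: upt_Suc)
  then have "edge \<sigma> k = Psi (\<gamma> k) - Psi (\<gamma> (Suc k))" if "k < n" for k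
    using that by (simp add: edge_def Psi_def)
  ultimately show thesis by (intro that[of \<sigma>]) (auto simp: simplices_of_dim_def)
qed

lemma det_tensor_rank_le_orbits:
  "tensor_rank (det_tensor :: (real, 'n, 'n) tensor) \<le> card (simplex_orbits K act CARD('n))"
proof -
  let ?n = "CARD('n)" and ?Orb = "simplex_orbits K act CARD('n)"
  have fin: "finite ?Orb" by (rule finite_simplex_orbits)
  obtain L :: "'n list" where L: "distinct L" "set L = UNIV"
    using finite_distinct_list[of "UNIV :: 'n set"] by auto
  have len: "length L = ?n" using L distinct_card by fastforce
  define rep where "rep Q = (SOME \<sigma>. \<sigma> \<in> simplices_of_dim K ?n \<and> range (\<lambda>g. act g ` \<sigma>) = Q)" for Q
  have rep: "rep Q \<in> simplices_of_dim K ?n \<and> range (\<lambda>g. act g ` rep Q) = Q" if "Q \<in> ?Orb" for Q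
    unfolding rep_def by (rule someI_ex) (use that in \<open>auto simp: simplex_orbits_def\<close>)
  define V where "V = {f. \<exists>C. \<forall>J. f J = (\<Sum>Q\<in>?Orb. C Q * simplex_tensor L (rep Q) J)}"
  have V: "function_subspace V"
    unfolding function_subspace_def
  proof (intro conjI ballI allI)
    show "(\<lambda>x. 0) \<in> V" unfolding V_def by (intro CollectI exI[of _ "\<lambda>Q. 0"]) simp
  next
    fix f g assume "f \<in> V" "g \<in> V"
    then obtain C D where "\<forall>J. f J = (\<Sum>Q\<in>?Orb. C Q * simplex_tensor L (rep Q) J)"
      "\<forall>J. g J = (\<Sum>Q\<in>?Orb. D Q * simplex_tensor L (rep Q) J)" by (auto simp: V_def)
    then show "(\<lambda>x. f x + g x) \<in> V"
      unfolding V_def by (intro CollectI exI[of _ "\<lambda>Q. C Q + D Q"]) (simp add: algebra_simps sum.distrib)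
  next
    fix f a assume "f \<in> V"
    then obtain C where "\<forall>J. f J = (\<Sum>Q\<in>?Orb. C Q * simplex_tensor L (rep Q) J)" by (auto simp: V_def)
    then show "(\<lambda>x. a * f x) \<in> V"
      unfolding V_def by (intro CollectI exI[of _ "\<lambda>Q. a * C Q"]) (simp add: sum_distrib_left mult.assoc)
  qed
  have simplex_V: "simplex_tensor L \<sigma> \<in> V"
    if \<sigma>: "\<sigma> \<in> simplices_of_dim K ?n" and card: "card (lam ` coord ` \<sigma>) = Suc ?n" for \<sigma>
  proof -
    define Q where "Q = range (\<lambda>g. act g ` \<sigma>)"
    have Q: "Q \<in> ?Orb" using \<sigma> by (auto simp: Q_def simplex_orbits_def)
    have \<sigma>K: "\<sigma> \<in> K" using \<sigma> by (simp add: simplices_of_dim_def)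
    have "act 0 ` \<sigma> = id ` \<sigma>" by (intro image_cong refl) (metis UnionI \<sigma>K act_0 id_apply)
    then have "\<sigma> \<in> Q" unfolding Q_def by (metis image_id rangeI id_apply)
    then obtain g where g: "\<sigma> = act g ` rep Q" using rep[OF Q] by blast
    have repK: "rep Q \<in> K" using rep[OF Q] by (simp add: simplices_of_dim_def)
    \<comment> \<open>Distinctness of the coordinates passes to the representative and keeps all
      positions in range for \<open>edge_act\<close>.\<close>
    have "card (lam ` coord ` rep Q) = Suc ?n"
      using card unfolding g lam_coord_act[OF repK] by (simp add: card_image)
    then have "edge \<sigma> k = edge (rep Q) k" if "k < length L" for k
      unfolding g using edge_act[OF repK] that len by simp
    then have "simplex_tensor L \<sigma> = simplex_tensor L (rep Q)"
      unfolding simplex_tensor_def by (intro ext prod.cong refl) simp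
    moreover have "simplex_tensor L (rep Q) J = (\<Sum>P\<in>?Orb. (if P = Q then 1 else 0) * simplex_tensor L (rep P) J)" for J
    proof -
      have "(\<Sum>P\<in>?Orb. (if P = Q then 1 else 0) * simplex_tensor L (rep P) J)
          = (\<Sum>P\<in>?Orb. if P = Q then simplex_tensor L (rep P) J else 0)"
        by (rule sum.cong) auto
      then show ?thesis using fin Q by simp
    qed
    ultimately show ?thesis unfolding V_def by auto
  qed
  have cup_V: "(\<lambda>J. cup Psi (map J L) c) \<in> V" for c
  proof (rule cup_in_subspace[OF V])
    fix \<gamma> :: "nat \<Rightarrow> int ^ 'n" assume fac: "\<And>k. k < length L \<Longrightarrow> facet (\<gamma> (Suc k)) (\<gamma> k)"
    show "(\<lambda>J. \<Prod>k<length L. (Psi (\<gamma> k) - Psi (\<gamma> (Suc k))) $ J (L ! k)) \<in> V"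
    proof (cases "\<exists>k<length L. Psi (\<gamma> k) = Psi (\<gamma> (Suc k))")
      case True
      then obtain k where "k < length L" "Psi (\<gamma> k) = Psi (\<gamma> (Suc k))" by blast
      then have "(\<lambda>J. \<Prod>k<length L. (Psi (\<gamma> k) - Psi (\<gamma> (Suc k))) $ J (L ! k)) = (\<lambda>J. 0)"
        by (intro ext prod_zero bexI[of _ k]) auto
      then show ?thesis using V by (simp only: function_subspace_def)
    next
      case False
      obtain \<sigma> where \<sigma>: "\<sigma> \<in> simplices_of_dim K ?n" "card (lam ` coord ` \<sigma>) = Suc ?n"
        "\<And>k. k < ?n \<Longrightarrow> edge \<sigma> k = Psi (\<gamma> k) - Psi (\<gamma> (Suc k))"
        by (rule chain_tensor[of ?n \<gamma>]) (use fac False len in auto)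
      have "(\<lambda>J. \<Prod>k<length L. (Psi (\<gamma> k) - Psi (\<gamma> (Suc k))) $ J (L ! k)) = simplex_tensor L \<sigma>"
        unfolding simplex_tensor_def by (intro ext prod.cong refl) (simp add: \<sigma>(3) len)
      then show ?thesis using simplex_V[OF \<sigma>(1,2)] by simp
    qed
  qed
  obtain k where k: "\<And>J. det_tensor J = k * cup_integral M Psi (map J L) UNIV"
    using cup_integral_det_tensor[OF M equivariant_Psi L] by blast
  \<comment> \<open>The restriction to full-dimensional faces becomes a 0-1 coefficient, so that the
    sum is visibly a linear combination of elements of \<open>V\<close>.\<close>
  have "(\<lambda>J. k * (\<Sum>c\<in>period_box M. (if odd_coords c = UNIV then 1 else 0) * cup Psi (map J L) c)) \<in> V"
    by (intro function_subspace_scale[OF V] function_subspace_sum[OF V] cup_V finite_period_box)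
  moreover have "(\<lambda>J. k * (\<Sum>c\<in>period_box M. (if odd_coords c = UNIV then 1 else 0) * cup Psi (map J L) c)) = det_tensor"
    unfolding fun_eq_iff k cup_integral_def by (auto intro!: sum.cong)
  ultimately obtain C where C: "\<And>J. det_tensor J = (\<Sum>Q\<in>?Orb. C Q * simplex_tensor L (rep Q) J)"
    unfolding V_def by auto
  have "\<forall>Q. \<exists>v. \<forall>J. simplex_tensor L (rep Q) J = pure_tensor v J" using simplex_tensor_pure[OF L] by blast
  from choice[OF this] obtain v where "\<And>Q J. simplex_tensor L (rep Q) J = pure_tensor (v Q) J" by blast
  then have "(det_tensor :: (real, 'n, 'n) tensor) = (\<lambda>J. \<Sum>Q\<in>?Orb. C Q * pure_tensor (v Q) J)"
    using C by (intro ext) simp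
  then show ?thesis by (rule tensor_rank_le[OF fin])
qed

end

section \<open>Existence of a sufficiently fine grid\<close>

lemma (in lattice_triangulation) ex_grid_approximation:
  "\<exists>lam M s. grid_approximation K act h lam M s"
proof -
  obtain lam :: "int ^ 'n \<Rightarrow> real" where lam: "inj lam" "\<And>x y. lam (x + y) = lam x + lam y"
    using ex_injective_additive by blast
  from ex_star_radius obtain e where e: "0 < e" "\<forall>y\<in>cbox 0 1. \<exists>v\<in>\<Union>K. ball y e \<subseteq> h ` star v"
    by (elim exE conjE)
  \<comment> \<open>A displacement of at most \<open>1 / N\<close> in every coordinate then has norm
    below the Lebesgue number \<open>e\<close>.\<close>
  obtain N :: nat where N: "CARD('n) / e < N" using reals_Archimedean2 by blast
  have N0: "0 < N"
    by (rule Nat.gr0I) (use N e(1) in \<open>simp add: field_simps\<close>)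
  \<comment> \<open>The factor 2 makes the period even and turns two grid steps into
    \<open>1 / N\<close>.\<close>
  define M where "M = 2 * int N"
  have M: "0 < M" "even M" using N0 by (auto simp: M_def)
  define s0 where "s0 r = (SOME v. v \<in> \<Union>K \<and> ball (grid_point M r) e \<subseteq> h ` star v)" for r
  have s0: "s0 r \<in> \<Union>K \<and> ball (grid_point M r) e \<subseteq> h ` star (s0 r)" if "r \<in> period_box M" for r
    unfolding s0_def
  proof (rule someI_ex)
    have "grid_point M r \<in> cbox 0 1"
      using that M by (auto simp: mem_box_cart grid_point_def period_box_def intro: less_imp_le)
    then have "\<exists>v\<in>\<Union>K. ball (grid_point M r) e \<subseteq> h ` star v" by (rule e(2)[THEN bspec])
    then show "\<exists>v. v \<in> \<Union>K \<and> ball (grid_point M r) e \<subseteq> h ` star v" unfolding Bex_def .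
  qed
  \<comment> \<open>Choices are made on one period only and extended by the action, so equivariance
    holds by construction.\<close>
  define s where "s w = act (div_vec w M) (s0 (mod_vec w M))" for w
  have s0_vertex: "s0 (mod_vec w M) \<in> \<Union>K" for w using s0 mod_vec_in_box[OF M(1)] by blast
  have "grid_approximation K act h lam M s"
  proof unfold_locales
    show "s w \<in> \<Union>K" for w unfolding s_def by (rule act_vertex[OF s0_vertex])
    show "s (w + scale_vec M g) = act g (s w)" for w g
    proof -
      have "s (w + scale_vec M g) = act (g + div_vec w M) (s0 (mod_vec w M))"
        by (simp add: s_def mod_vec_add_scale[OF M(1)] div_vec_add_scale[OF M(1)] add.commute)
      then show ?thesis unfolding s_def using act_add[OF s0_vertex] by simp
    qed
    show "grid_point M w \<in> h ` star (s w')" if close: "\<And>i. \<bar>w $ i - w' $ i\<bar> \<le> 2" for w w'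
    proof -
      \<comment> \<open>Subtracting the lattice vector \<open>?q\<close> brings the grid point of
        \<open>w'\<close> to that of \<open>?r\<close> in the period box, where the ball of radius
        \<open>e\<close> is available; \<open>star_act\<close> carries the conclusion back.\<close>
      let ?q = "div_vec w' M" and ?r = "mod_vec w' M"
      have "grid_point M (?r + scale_vec M ?q) = grid_point M ?r + lattice_vec ?q"
        using M by (simp add: grid_point_def lattice_vec_def scale_vec_def vec_eq_iff add_divide_distrib)
      then have w': "grid_point M w' = grid_point M ?r + lattice_vec ?q" unfolding mod_div_vec .
      have "norm (grid_point M w' - grid_point M w) \<le> (\<Sum>i\<in>UNIV. \<bar>(grid_point M w' - grid_point M w) $ i\<bar>)"
        by (rule norm_le_l1_cart)
      also have "\<dots> \<le> (\<Sum>i\<in>(UNIV :: 'n set). 1 / N)"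
      proof (rule sum_mono)
        fix i
        have "\<bar>real_of_int (w' $ i - w $ i)\<bar> \<le> 2" using close[of i] by linarith
        then have "\<bar>real_of_int (w' $ i - w $ i)\<bar> / (2 * N) \<le> 2 / (2 * N)" by (rule divide_right_mono) simp
        moreover have "(grid_point M w' - grid_point M w) $ i = real_of_int (w' $ i - w $ i) / (2 * N)"
          by (simp add: grid_point_def M_def diff_divide_distrib)
        ultimately show "\<bar>(grid_point M w' - grid_point M w) $ i\<bar> \<le> 1 / N"
          by (simp add: abs_divide del: of_int_diff)
      qed
      also have "\<dots> < e" using N N0 e(1) by (simp add: field_simps)
      finally have "grid_point M w - lattice_vec ?q \<in> ball (grid_point M ?r) e"
        by (simp add: w' dist_norm algebra_simps)
      then have "grid_point M w - lattice_vec ?q \<in> h ` star (s0 ?r)"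
        using s0 mod_vec_in_box[OF M(1)] by blast
      from star_act[OF s0_vertex this, of ?q] show ?thesis by (simp add: s_def)
    qed
  qed (use lam M in auto)
  then show ?thesis by blast
qed

theorem theorem3:
  fixes K :: "'v set set" and act :: "int ^ 'n \<Rightarrow> 'v \<Rightarrow> 'v"
  shows "(invariant_triangulation K act \<longrightarrow>
            tensor_rank (det_tensor :: (real, 'n, 'n) tensor)
              \<le> card (simplex_orbits K act CARD('n))) \<and>
         real (CARD('n) ^ (CARD('n) - 1)) / fact (CARD('n) - 1)
            \<le> real (tensor_rank (det_tensor :: (real, 'n, 'n) tensor))"
proof (intro conjI impI)
  assume "invariant_triangulation K act"
  then obtain h :: "('v \<Rightarrow> real) \<Rightarrow> real ^ 'n" where "lattice_triangulation K act h"
    unfolding invariant_triangulation_def lattice_triangulation_def by blast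
  then obtain lam M s where "grid_approximation K act h lam M s"
    using lattice_triangulation.ex_grid_approximation by blast
  then show "tensor_rank (det_tensor :: (real, 'n, 'n) tensor) \<le> card (simplex_orbits K act CARD('n))"
    by (rule grid_approximation.det_tensor_rank_le_orbits)
qed (rule det_tensor_rank_lower_bound)

end
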